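(* For every rational number $\alpha \in (\tfrac{1}{2}, 1]$ there exists a connected reductive linear algebraic group $G$ over $\mathbb{C}$ such that $p(G) = \alpha$.
   Context: For a linear algebraic group $G$ over $\mathbb{C}$, let $C(G) := \{(a,b) \in G \times G : ab = ba\}$, a Zariski closed subset of $G \times G$. The commuting probability of $G$ is defined as $p(G) := \dfrac{\dim C(G)}{\dim (G\times G)} = \dfrac{\dim C(G)}{2\dim G}$ if $\dim G > 0$, and $p(G) := 1$ if $G$ is finite. *)

theory Defs
  imports
    "HOL-Analysis.Abstract_Topology"
    "HOL-Library.Extended_Nat"
    "HOL-Algebra.Coset"
    "Jordan_Normal_Form.Matrix"
begin

section \<open>Zariski topology\<close>

text \<open>The functions that are polynomials with complex coefficients in the coordinate
  functions in \<open>X\<close>. Taking \<open>X\<close> as a parameter allows the affine space of matrices and that of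
  pairs of matrices to be treated alike.\<close>

inductive_set polynomial_functions :: "('a \<Rightarrow> complex) set \<Rightarrow> ('a \<Rightarrow> complex) set"
  for X :: "('a \<Rightarrow> complex) set"
where
  const: "(\<lambda>_. c) \<in> polynomial_functions X"
| coord: "x \<in> X \<Longrightarrow> x \<in> polynomial_functions X"
| add: "f \<in> polynomial_functions X \<Longrightarrow> g \<in> polynomial_functions X
    \<Longrightarrow> (\<lambda>p. f p + g p) \<in> polynomial_functions X"
| mult: "f \<in> polynomial_functions X \<Longrightarrow> g \<in> polynomial_functions X
    \<Longrightarrow> (\<lambda>p. f p * g p) \<in> polynomial_functions X"

definition zero_locus :: "('a \<Rightarrow> complex) set \<Rightarrow> 'a set"
  where "zero_locus F = {p. \<forall>f\<in>F. f p = 0}"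

text \<open>The topology on \<open>S\<close> induced by the Zariski topology of the affine space with coordinates
  \<open>X\<close>; see \<open>closedin_zariski\<close> and \<open>subtopology_zariski\<close>.\<close>

definition zariski :: "('a \<Rightarrow> complex) set \<Rightarrow> 'a set \<Rightarrow> 'a topology"
  where "zariski X S = topology (\<lambda>U. \<exists>F \<subseteq> polynomial_functions X. U = S - zero_locus F)"

lemma istopology_zariski:
  "istopology (\<lambda>U. \<exists>F \<subseteq> polynomial_functions X. U = S - zero_locus F)"
  unfolding istopology_def
proof (intro conjI allI impI)
  fix U V
  assume "\<exists>F \<subseteq> polynomial_functions X. U = S - zero_locus F"
    and "\<exists>F \<subseteq> polynomial_functions X. V = S - zero_locus F"
  then obtain F G where F: "F \<subseteq> polynomial_functions X" "U = S - zero_locus F"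
    and G: "G \<subseteq> polynomial_functions X" "V = S - zero_locus G"
    by blast
  let ?H = "{\<lambda>p. f p * g p | f g. f \<in> F \<and> g \<in> G}"
  have "?H \<subseteq> polynomial_functions X"
    using F(1) G(1) by (auto intro!: polynomial_functions.mult)
  moreover have "p \<in> zero_locus ?H \<longleftrightarrow> p \<in> zero_locus F \<or> p \<in> zero_locus G" for p
  proof
    assume p: "p \<in> zero_locus ?H"
    show "p \<in> zero_locus F \<or> p \<in> zero_locus G"
    proof (rule ccontr)
      assume "\<not> ?thesis"
      then obtain f g where fg: "f \<in> F" "f p \<noteq> 0" "g \<in> G" "g p \<noteq> 0"
        by (auto simp: zero_locus_def)
      have "\<forall>h\<in>?H. h p = 0" using p by (simp only: zero_locus_def mem_Collect_eq)
      moreover have "(\<lambda>p. f p * g p) \<in> ?H" using fg by blast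
      ultimately have "(\<lambda>p. f p * g p) p = 0" by (rule bspec)
      then show False using fg by simp
    qed
  next
    assume "p \<in> zero_locus F \<or> p \<in> zero_locus G"
    then show "p \<in> zero_locus ?H" by (auto simp: zero_locus_def)
  qed
  ultimately show "\<exists>F \<subseteq> polynomial_functions X. U \<inter> V = S - zero_locus F"
    using F(2) G(2) by (intro exI[of _ ?H]) blast
next
  fix K
  assume "\<forall>U\<in>K. \<exists>F \<subseteq> polynomial_functions X. U = S - zero_locus F"
  then obtain F where F: "\<And>U. U \<in> K \<Longrightarrow> F U \<subseteq> polynomial_functions X"
      "\<And>U. U \<in> K \<Longrightarrow> U = S - zero_locus (F U)"
    by metis
  have "(\<Union>U\<in>K. F U) \<subseteq> polynomial_functions X" using F(1) by blast
  moreover have "zero_locus (\<Union>U\<in>K. F U) = (\<Inter>U\<in>K. zero_locus (F U))"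
    by (auto simp: zero_locus_def)
  then have "\<Union>K = S - zero_locus (\<Union>U\<in>K. F U)" using F(2) by auto
  ultimately show "\<exists>F \<subseteq> polynomial_functions X. \<Union>K = S - zero_locus F" by blast
qed

lemma openin_zariski:
  "openin (zariski X S) U \<longleftrightarrow> (\<exists>F \<subseteq> polynomial_functions X. U = S - zero_locus F)"
  unfolding zariski_def by (simp add: topology_inverse'[OF istopology_zariski])

lemma topspace_zariski [simp]: "topspace (zariski X S) = S"
proof
  show "topspace (zariski X S) \<subseteq> S"
    by (auto simp: topspace_def openin_zariski)
  have "openin (zariski X S) S"
    unfolding openin_zariski
    by (rule exI[of _ "{\<lambda>_. 1}"]) (auto simp: zero_locus_def intro: polynomial_functions.const)
  then show "S \<subseteq> topspace (zariski X S)" by (rule openin_subset)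
qed

lemma closedin_zariski:
  "closedin (zariski X S) Z \<longleftrightarrow> (\<exists>F \<subseteq> polynomial_functions X. Z = S \<inter> zero_locus F)"
proof
  assume "closedin (zariski X S) Z"
  then have Z: "Z \<subseteq> S" and "openin (zariski X S) (S - Z)"
    by (auto simp: closedin_def)
  then obtain F where F: "F \<subseteq> polynomial_functions X" "S - Z = S - zero_locus F"
    by (auto simp: openin_zariski)
  have "Z = S \<inter> zero_locus F" using Z F(2) by blast
  with F(1) show "\<exists>F \<subseteq> polynomial_functions X. Z = S \<inter> zero_locus F" by blast
next
  assume "\<exists>F \<subseteq> polynomial_functions X. Z = S \<inter> zero_locus F"
  then obtain F where F: "F \<subseteq> polynomial_functions X" "Z = S \<inter> zero_locus F" by blast
  have "S - Z = S - zero_locus F" using F(2) by blast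
  then show "closedin (zariski X S) Z"
    using F by (auto simp: closedin_def openin_zariski)
qed

lemma subtopology_zariski:
  assumes "T \<subseteq> S"
  shows "subtopology (zariski X S) T = zariski X T"
  unfolding topology_eq openin_subtopology openin_zariski
proof
  fix U
  have eq: "(S - Z) \<inter> T = T - Z" for Z using assms by blast
  have "(\<exists>W. (\<exists>F \<subseteq> polynomial_functions X. W = S - zero_locus F) \<and> U = W \<inter> T)
    \<longleftrightarrow> (\<exists>F \<subseteq> polynomial_functions X. U = (S - zero_locus F) \<inter> T)"
    by blast
  then show "(\<exists>W. (\<exists>F \<subseteq> polynomial_functions X. W = S - zero_locus F) \<and> U = W \<inter> T)
    \<longleftrightarrow> (\<exists>F \<subseteq> polynomial_functions X. U = T - zero_locus F)"
    by (simp only: eq)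
qed

section \<open>Dimension\<close>

definition irreducible_space :: "'a topology \<Rightarrow> bool"
  where "irreducible_space T \<longleftrightarrow> topspace T \<noteq> {} \<and>
    (\<forall>A B. closedin T A \<and> closedin T B \<and> A \<union> B = topspace T
       \<longrightarrow> A = topspace T \<or> B = topspace T)"

text \<open>Krull dimension: the supremum of the lengths \<open>m\<close> of chains
  \<open>Z 0 \<subset> \<dots> \<subset> Z m\<close> of irreducible closed subsets.\<close>

definition krull_dim :: "'a topology \<Rightarrow> enat"
  where "krull_dim T = Sup {enat m | m. \<exists>Z :: nat \<Rightarrow> 'a set.
    (\<forall>i\<le>m. closedin T (Z i) \<and> irreducible_space (subtopology T (Z i))) \<and>
    (\<forall>i<m. Z i \<subset> Z (Suc i))}"

section \<open>Linear algebraic groups\<close>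

abbreviation GL :: "nat \<Rightarrow> complex mat monoid"
  where "GL n \<equiv> units_of (ring_mat TYPE(complex) n ())"

definition mat_coords :: "nat \<Rightarrow> (complex mat \<Rightarrow> complex) set"
  where "mat_coords n = {\<lambda>A. A $$ (i, j) | i j. i < n \<and> j < n}"

definition mat_pair_coords :: "nat \<Rightarrow> (complex mat \<times> complex mat \<Rightarrow> complex) set"
  where "mat_pair_coords n = {\<lambda>p. x (fst p) | x. x \<in> mat_coords n}
    \<union> {\<lambda>p. x (snd p) | x. x \<in> mat_coords n}"

abbreviation zariski_mat :: "nat \<Rightarrow> complex mat set \<Rightarrow> complex mat topology"
  where "zariski_mat n \<equiv> zariski (mat_coords n)"

text \<open>The Zariski topology on sets of pairs of matrices; on a product \<open>G \<times> H\<close> it is in general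
  strictly finer than the product of the Zariski topologies of \<open>G\<close> and \<open>H\<close>.\<close>

abbreviation zariski_mat_pair ::
    "nat \<Rightarrow> (complex mat \<times> complex mat) set \<Rightarrow> (complex mat \<times> complex mat) topology"
  where "zariski_mat_pair n \<equiv> zariski (mat_pair_coords n)"

text \<open>A linear algebraic group over the complex numbers is a Zariski closed subgroup of some
  \<open>GL n\<close>. Polynomials in the entries suffice to define the closed subsets of \<open>GL n\<close>: allowing
  the inverse of the determinant as a further coordinate yields the same zero loci.\<close>

definition linear_algebraic_group :: "nat \<Rightarrow> complex mat set \<Rightarrow> bool"
  where "linear_algebraic_group n G \<longleftrightarrow>
    subgroup G (GL n) \<and> closedin (zariski_mat n (carrier (GL n))) G"

definition connected_alg_group :: "nat \<Rightarrow> complex mat set \<Rightarrow> bool"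
  where "connected_alg_group n G \<longleftrightarrow> connected_space (zariski_mat n G)"

definition unipotent_mat :: "nat \<Rightarrow> complex mat \<Rightarrow> bool"
  where "unipotent_mat n A \<longleftrightarrow> A \<in> carrier_mat n n \<and> (\<exists>k. (A - 1\<^sub>m n) ^\<^sub>m k = 0\<^sub>m n n)"

text \<open>The unipotent radical is the largest closed connected normal unipotent subgroup, hence
  the union of all of them.\<close>

definition unipotent_radical :: "nat \<Rightarrow> complex mat set \<Rightarrow> complex mat set"
  where "unipotent_radical n G = \<Union> {U. linear_algebraic_group n U \<and>
    U \<lhd> (GL n\<lparr>carrier := G\<rparr>) \<and> connected_alg_group n U \<and> (\<forall>A\<in>U. unipotent_mat n A)}"

definition reductive :: "nat \<Rightarrow> complex mat set \<Rightarrow> bool"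
  where "reductive n G \<longleftrightarrow> unipotent_radical n G = {1\<^sub>m n}"

section \<open>Commuting probability\<close>

definition commuting_pairs :: "complex mat set \<Rightarrow> (complex mat \<times> complex mat) set"
  where "commuting_pairs G = {(A, B). A \<in> G \<and> B \<in> G \<and> A * B = B * A}"

text \<open>A linear algebraic group is finite if and only if its dimension is zero. Both dimensions
  below are finite, so \<open>the_enat\<close> only converts the type.\<close>

definition commuting_probability :: "nat \<Rightarrow> complex mat set \<Rightarrow> real"
  where "commuting_probability n G =
    (if krull_dim (zariski_mat n G) > 0
     then real (the_enat (krull_dim (zariski_mat_pair n (commuting_pairs G))))
        / real (the_enat (krull_dim (zariski_mat_pair n (G \<times> G))))
     else 1)"

end

theory Submission
  imports Defs "Jordan_Normal_Form.Jordan_Normal_Form_Existence"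
begin

text \<open>The groups \<open>G = GL k \<times> T b\<close>, with \<open>T b\<close> a torus of rank \<open>b\<close>, suffice: they are connected
  reductive of dimension \<open>k\<^sup>2 + b\<close>, and \<open>dim C(G) = k\<^sup>2 + k + 2 b\<close>. If \<open>2 \<alpha> - 1 = p / q\<close> with
  \<open>p < q\<close>, then \<open>k = q (q - p)\<close> and \<open>b = q (p k - q)\<close> yield the commuting probability \<open>\<alpha>\<close>;
  for \<open>\<alpha> = 1\<close> take \<open>GL 1\<close>.

  All dimensions are computed from a dominant polynomial map \<open>\<phi>\<close> from an affine space of dimension
  \<open>M\<close>. A chain of \<open>M + 2\<close> irreducible closed sets would yield \<open>M + 1\<close> algebraically independent
  polynomials in \<open>M\<close> variables, which is impossible. Conversely the closures of the images under
  \<open>\<phi>\<close> of a flag of coordinate subspaces form a chain of length \<open>M\<close>, provided that consecutive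
  closures are distinct. For \<open>C(GL k)\<close> the map sends a matrix \<open>A\<close> and a polynomial \<open>f\<close> of degree
  below \<open>k\<close> to \<open>(A, f(A))\<close>; it is dominant by the theorem of Motzkin and Taussky.\<close>

section \<open>Polynomial functions\<close>

text \<open>\<open>GL k\<close> alone has commuting probability 1/2 + 1/(2 k). A torus of rank
  \<open>b\<close> adds \<open>2 b\<close> both to dim C(G) and to dim (G x G), which moves the
  value towards 1; the two parameters together leave enough freedom for every rational number above
  1/2. As Krull dimension is defined by chains, the lower bounds need explicit ones. For the groups
  and their squares every parameter is a matrix entry and can be read off. For C(GL k) it cannot: at
  A = 1 all powers of A coincide, and f(A) does not reveal the coefficients of f. Hence the entries
  of A are set free before these coefficients. The parametrizations are defined on whole affine
  spaces and also take singular values. A polynomial \<open>h\<close>, nonzero at a base point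
  shared by all coordinate subspaces, singles out parameters that map into the group.\<close>

lemma polynomial_functions_sum:
  assumes "\<And>i. i \<in> I \<Longrightarrow> f i \<in> polynomial_functions X"
  shows "(\<lambda>p. \<Sum>i\<in>I. f i p) \<in> polynomial_functions X"
  using assms
  by (induction I rule: infinite_finite_induct)
    (auto intro: polynomial_functions.const polynomial_functions.add)

lemma polynomial_functions_prod:
  assumes "\<And>i. i \<in> I \<Longrightarrow> f i \<in> polynomial_functions X"
  shows "(\<lambda>p. \<Prod>i\<in>I. f i p) \<in> polynomial_functions X"
  using assms
  by (induction I rule: infinite_finite_induct)
    (auto intro: polynomial_functions.const polynomial_functions.mult)

lemma polynomial_functions_power:
  assumes "f \<in> polynomial_functions X"
  shows "(\<lambda>p. f p ^ k) \<in> polynomial_functions X"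
  by (induction k) (auto intro: polynomial_functions.const polynomial_functions.mult assms)

lemma polynomial_functions_diff:
  assumes "f \<in> polynomial_functions X" and "g \<in> polynomial_functions X"
  shows "(\<lambda>p. f p - g p) \<in> polynomial_functions X"
proof -
  have "(\<lambda>p. f p + (\<lambda>_. - 1) p * g p) \<in> polynomial_functions X"
    using assms by (intro polynomial_functions.add polynomial_functions.mult polynomial_functions.const)
  then show ?thesis by simp
qed

lemmas polynomial_functions_intros =
  polynomial_functions.const polynomial_functions.add polynomial_functions.mult
  polynomial_functions_sum polynomial_functions_prod polynomial_functions_power
  polynomial_functions_diff

lemma polynomial_functions_compose:
  assumes "f \<in> polynomial_functions X"
    and "\<And>x. x \<in> X \<Longrightarrow> (\<lambda>q. x (\<phi> q)) \<in> polynomial_functions Y"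
  shows "(\<lambda>q. f (\<phi> q)) \<in> polynomial_functions Y"
  using assms(1) by induction (auto intro: polynomial_functions_intros assms(2))

lemma polynomial_functions_id_poly:
  assumes "f \<in> polynomial_functions {\<lambda>t. t}"
  obtains p where "f = poly p"
proof -
  have "\<exists>p. f = poly p" using assms
  proof induction
    case (const c)
    show ?case by (rule exI[of _ "[:c:]"]) auto
  next
    case (coord x)
    then show ?case by (intro exI[of _ "[:0, 1:]"]) auto
  next
    case (add f g)
    then obtain p q where "f = poly p" "g = poly q" by auto
    then show ?case by (intro exI[of _ "p + q"]) auto
  next
    case (mult f g)
    then obtain p q where "f = poly p" "g = poly q" by auto
    then show ?case by (intro exI[of _ "p * q"]) auto
  qed
  then show thesis using that by auto
qed

text \<open>The product of two nonzero polynomials in one variable is nonzero, so over an infinite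
  field it has a nonzero value. The irreducibility of parametrized sets and the argument of Motzkin
  and Taussky both rest on this.\<close>

lemma polynomial_functions_id_domain:
  assumes "f \<in> polynomial_functions {\<lambda>t. t}" and "g \<in> polynomial_functions {\<lambda>t. t}"
    and "f s \<noteq> 0" and "g t \<noteq> 0"
  obtains u where "f u \<noteq> 0" "g u \<noteq> 0"
proof -
  obtain p q where "f = poly p" "g = poly q"
    using assms(1,2) polynomial_functions_id_poly by metis
  moreover from this have "p * q \<noteq> 0" using assms(3,4) by auto
  then obtain u where "poly (p * q) u \<noteq> 0" using poly_all_0_iff_0 by blast
  ultimately show thesis using that[of u] by simp
qed

text \<open>Affine \<open>M\<close>-space is modelled by all functions on \<open>nat\<close>, of
  which polynomial functions see only the first \<open>M\<close> values. This dispenses with a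
  carrier set.\<close>

abbreviation nat_coords :: "nat \<Rightarrow> ((nat \<Rightarrow> complex) \<Rightarrow> complex) set"
  where "nat_coords M \<equiv> {\<lambda>x. x i | i. i < M}"

lemma nat_coord_polynomial: "i < M \<Longrightarrow> (\<lambda>x. x i) \<in> polynomial_functions (nat_coords M)"
  by (auto intro: polynomial_functions.coord)

text \<open>Restriction to the line through \<open>x\<close> and \<open>y\<close> reduces the claim
  to one variable. A common point on this very line keeps every coordinate in which \<open>x\<close>
  and \<open>y\<close> agree, hence stays in coordinate subspaces.\<close>

lemma nat_coords_line_domain:
  assumes f: "f \<in> polynomial_functions (nat_coords M)" "f x \<noteq> 0"
    and g: "g \<in> polynomial_functions (nat_coords M)" "g y \<noteq> 0"
  obtains t where "f (\<lambda>i. x i + t * (y i - x i)) \<noteq> 0" "g (\<lambda>i. x i + t * (y i - x i)) \<noteq> 0"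
proof -
  let ?l = "\<lambda>t i. x i + t * (y i - x i)"
  have line: "(\<lambda>t. z (?l t)) \<in> polynomial_functions {\<lambda>t. t}" if "z \<in> nat_coords M" for z
    using that by (auto intro!: polynomial_functions_intros intro: polynomial_functions.coord)
  have "f (?l 0) \<noteq> 0" "g (?l 1) \<noteq> 0" using f(2) g(2) by simp_all
  moreover have "(\<lambda>t. f (?l t)) \<in> polynomial_functions {\<lambda>t. t}"
    "(\<lambda>t. g (?l t)) \<in> polynomial_functions {\<lambda>t. t}"
    by (rule polynomial_functions_compose[where \<phi> = ?l], fact, erule line)+
  ultimately obtain t where "f (?l t) \<noteq> 0" "g (?l t) \<noteq> 0"
    using polynomial_functions_id_domain[of "\<lambda>t. f (?l t)" "\<lambda>t. g (?l t)" 0 1] by blast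
  then show thesis by (rule that)
qed

section \<open>Irreducibility\<close>

text \<open>Irreducibility is primality of the vanishing ideal: if two proper closed subsets cover
  \<open>Z\<close>, a suitable equation of one times one of the other vanishes on \<open>Z\<close>,
  although neither factor does.\<close>

lemma irreducible_zariskiI:
  assumes "Z \<noteq> {}"
    and "\<And>f g. \<lbrakk>f \<in> polynomial_functions X; g \<in> polynomial_functions X; \<forall>p\<in>Z. f p * g p = 0\<rbrakk>
      \<Longrightarrow> (\<forall>p\<in>Z. f p = 0) \<or> (\<forall>p\<in>Z. g p = 0)"
  shows "irreducible_space (zariski X Z)"
  unfolding irreducible_space_def topspace_zariski
proof (intro conjI allI impI)
  fix A B
  assume AB: "closedin (zariski X Z) A \<and> closedin (zariski X Z) B \<and> A \<union> B = Z"
  then obtain F G where F: "F \<subseteq> polynomial_functions X" "A = Z \<inter> zero_locus F"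
    and G: "G \<subseteq> polynomial_functions X" "B = Z \<inter> zero_locus G"
    by (auto simp: closedin_zariski)
  show "A = Z \<or> B = Z"
  proof (rule ccontr)
    assume "\<not> ?thesis"
    then obtain p q where "p \<in> Z - A" "q \<in> Z - B" using F(2) G(2) by blast
    then obtain f g where fg: "f \<in> F" "f p \<noteq> 0" "g \<in> G" "g q \<noteq> 0" "p \<in> Z" "q \<in> Z"
      using F(2) G(2) by (auto simp: zero_locus_def)
    have "f r * g r = 0" if "r \<in> Z" for r
    proof -
      have "r \<in> A \<or> r \<in> B" using that AB by blast
      then show ?thesis using F(2) G(2) fg by (auto simp: zero_locus_def)
    qed
    then show False using assms(2)[of f g] F(1) G(1) fg by blast
  qed
qed (use assms(1) in auto)

lemma irreducible_zariskiD:
  assumes "irreducible_space (zariski X Z)"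
    and "f \<in> polynomial_functions X" and "g \<in> polynomial_functions X"
    and "\<forall>p\<in>Z. f p * g p = 0"
  shows "(\<forall>p\<in>Z. f p = 0) \<or> (\<forall>p\<in>Z. g p = 0)"
proof -
  let ?A = "Z \<inter> zero_locus {f}" and ?B = "Z \<inter> zero_locus {g}"
  have "closedin (zariski X Z) ?A" "closedin (zariski X Z) ?B"
    using assms(2,3) by (auto simp: closedin_zariski)
  moreover have "?A \<union> ?B = Z" using assms(4) by (auto simp: zero_locus_def)
  ultimately have "?A = Z \<or> ?B = Z"
    using assms(1) unfolding irreducible_space_def by auto
  moreover have "\<forall>p\<in>Z. u p = 0" if "Z \<inter> zero_locus {u} = Z" for u
  proof
    fix p assume "p \<in> Z"
    then have "p \<in> zero_locus {u}" using that by blast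
    then show "u p = 0" by (simp add: zero_locus_def)
  qed
  ultimately show ?thesis by blast
qed

lemma irreducible_imp_connected_space:
  assumes "irreducible_space T"
  shows "connected_space T"
  unfolding connected_space_def
proof (intro notI, elim exE conjE)
  fix U V
  assume UV: "openin T U" "openin T V" "topspace T \<subseteq> U \<union> V" "U \<inter> V = {}" "U \<noteq> {}" "V \<noteq> {}"
  have "closedin T (topspace T - U)" "closedin T (topspace T - V)"
    using UV(1,2) by auto
  moreover have "(topspace T - U) \<union> (topspace T - V) = topspace T" using UV(4) by blast
  ultimately have "topspace T - U = topspace T \<or> topspace T - V = topspace T"
    using assms unfolding irreducible_space_def by blast
  then show False using openin_subset[OF UV(1)] openin_subset[OF UV(2)] UV(5,6) by blast
qed

section \<open>Chains of irreducible closed sets\<close>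

text \<open>Modulo \<open>g m\<close> the relation reduces to one among the first \<open>m\<close> functions on \<open>Z m\<close>; since
  \<open>g m\<close> is not a zero divisor on \<open>Z (Suc m)\<close>, it can be cancelled and the argument repeated.\<close>

lemma chain_monomials_independent:
  fixes g :: "nat \<Rightarrow> 'a \<Rightarrow> complex"
  assumes "\<And>i. i \<le> m \<Longrightarrow> irreducible_space (zariski X (Z i))"
    and "\<And>i. i < m \<Longrightarrow> Z i \<subseteq> Z (Suc i)"
    and "\<And>i. i < m \<Longrightarrow> g i \<in> polynomial_functions X"
    and "\<And>i p. i < m \<Longrightarrow> p \<in> Z i \<Longrightarrow> g i p = 0"
    and "\<And>i. i < m \<Longrightarrow> \<exists>p\<in>Z (Suc i). g i p \<noteq> 0"
    and "\<And>p. p \<in> Z m \<Longrightarrow> (\<Sum>e\<in>PiE {..<m} (\<lambda>_. {..<E}). c e * (\<Prod>i<m. g i p ^ e i)) = 0"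
    and "e \<in> PiE {..<m} (\<lambda>_. {..<E})"
  shows "c e = 0"
  using assms
proof (induction m arbitrary: c e)
  case 0
  obtain p where "p \<in> Z 0" using "0.prems"(1)[of 0] by (auto simp: irreducible_space_def)
  from "0.prems"(6)[OF this] "0.prems"(7) show ?case by simp
next
  case (Suc m)
  note prems = Suc.prems
  let ?P = "PiE {..<m} (\<lambda>_. {..<E})"
  define a where "a j p = (\<Sum>e\<in>?P. c (e(m := j)) * (\<Prod>i<m. g i p ^ e i))" for j p
  have a_poly: "a j \<in> polynomial_functions X" for j
    unfolding a_def by (intro polynomial_functions_intros Suc.prems(3)) auto
  have PiE_Suc: "PiE {..<Suc m} (\<lambda>_. {..<E}) = (\<lambda>(j, e). e(m := j)) ` ({..<E} \<times> ?P)"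
    unfolding lessThan_Suc by (rule PiE_insert_eq)
  have "(\<Sum>e\<in>PiE {..<Suc m} (\<lambda>_. {..<E}). c e * (\<Prod>i<Suc m. g i p ^ e i))
      = (\<Sum>j<E. a j p * g m p ^ j)" for p
  proof -
    have inj: "inj_on (\<lambda>(j, e). e(m := j)) ({..<E} \<times> ?P)"
      by (rule inj_combinator) simp
    have prod_Suc: "(\<Prod>i<Suc m. g i p ^ (e(m := j)) i) = (\<Prod>i<m. g i p ^ e i) * g m p ^ j" for e j
      by (simp cong: prod.cong_simp)
    have "(\<Sum>e\<in>PiE {..<Suc m} (\<lambda>_. {..<E}). c e * (\<Prod>i<Suc m. g i p ^ e i))
      = (\<Sum>(j, e)\<in>{..<E} \<times> ?P. c (e(m := j)) * (\<Prod>i<m. g i p ^ e i) * g m p ^ j)"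
      unfolding PiE_Suc sum.reindex[OF inj] by (simp add: split_def o_def prod_Suc mult.assoc)
    also have "\<dots> = (\<Sum>j<E. a j p * g m p ^ j)"
      unfolding a_def sum_distrib_right by (simp add: sum.cartesian_product)
    finally show ?thesis .
  qed
  then have sum0: "(\<Sum>j<E. a j p * g m p ^ j) = 0" if "p \<in> Z (Suc m)" for p
    using Suc.prems(6)[OF that] by simp
  have IH: "c (e(m := j)) = 0" if "\<And>p. p \<in> Z m \<Longrightarrow> a j p = 0" "e \<in> ?P" for j e
  proof (rule Suc.IH[where c = "\<lambda>e. c (e(m := j))"])
    show "\<And>p. p \<in> Z m \<Longrightarrow> (\<Sum>e\<in>?P. c (e(m := j)) * (\<Prod>i<m. g i p ^ e i)) = 0"
      using that(1) unfolding a_def .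
  qed (use Suc.prems(1-5) that(2) in auto)
  \<comment> \<open>\<open>j\<close> factors \<open>g m\<close> have been cancelled: the left
    conjunct is the relation that remains on \<open>Z (Suc m)\<close>, the right one records the
    coefficients already known to vanish. The case j = E is the claim.\<close>
  have "(\<forall>p\<in>Z (Suc m). (\<Sum>l<E - j. a (j + l) p * g m p ^ l) = 0)
      \<and> (\<forall>j'<j. \<forall>e\<in>?P. c (e(m := j')) = 0)" if "j \<le> E" for j
    using that
  proof (induction j)
    case 0
    then show ?case using sum0 by simp
  next
    case (Suc j)
    note H = Suc.IH[OF Suc_leD[OF Suc.prems]]
    let ?r = "\<lambda>p. \<Sum>l<E - Suc j. a (Suc j + l) p * g m p ^ l"
    have Ej: "E - j = Suc (E - Suc j)" using Suc.prems by simp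
    have split: "(\<Sum>l<E - j. a (j + l) p * g m p ^ l) = a j p + g m p * ?r p" for p
      unfolding Ej sum.lessThan_Suc_shift by (simp add: sum_distrib_left mult_ac)
    have "a j p = 0" if "p \<in> Z m" for p
    proof -
      have "p \<in> Z (Suc m)" "g m p = 0" using that prems(2,4)[of m] by auto
      moreover from this have "a j p + g m p * ?r p = 0" unfolding split[symmetric] using H by blast
      ultimately show ?thesis by simp
    qed
    then have c0: "c (e(m := j)) = 0" if "e \<in> ?P" for e using IH that by blast
    then have "a j p = 0" for p by (simp add: a_def)
    then have "\<forall>p\<in>Z (Suc m). g m p * ?r p = 0" using H unfolding split by simp
    moreover have "?r \<in> polynomial_functions X" "g m \<in> polynomial_functions X"
      using prems(3)
      by (auto intro!: polynomial_functions_intros a_poly)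
    ultimately have "\<forall>p\<in>Z (Suc m). ?r p = 0"
      using irreducible_zariskiD[of X "Z (Suc m)" "g m" ?r]
        prems(1)[of "Suc m"] prems(5)[of m] by blast
    moreover have "\<forall>j'<Suc j. \<forall>e\<in>?P. c (e(m := j')) = 0" using c0 H by (metis less_Suc_eq)
    ultimately show ?case by blast
  qed
  from this[of E] have "\<forall>j<E. \<forall>e\<in>?P. c (e(m := j)) = 0" by simp
  then show ?case using Suc.prems(7) unfolding PiE_Suc by auto
qed

section \<open>Algebraic dependence of \<open>Suc M\<close> polynomials in \<open>M\<close>
  variables\<close>

lemma homogeneous_system_nontrivial:
  fixes a :: "'i \<Rightarrow> 'j \<Rightarrow> 'k::field"
  assumes "finite T" and "finite I" and "card T < card I"
  shows "\<exists>c. (\<exists>i\<in>I. c i \<noteq> 0) \<and> (\<forall>j\<in>T. (\<Sum>i\<in>I. c i * a i j) = 0)"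
  using assms
proof (induction T arbitrary: I a rule: finite_induct)
  case empty
  then obtain i where "i \<in> I" by fastforce
  then show ?case by (intro exI[of _ "\<lambda>_. 1"]) auto
next
  case (insert j T)
  show ?case
  proof (cases "\<forall>i\<in>I. a i j = 0")
    case True
    then show ?thesis using insert.IH[of I a] insert.prems insert.hyps by auto
  next
    case False
    then obtain k where k: "k \<in> I" "a k j \<noteq> 0" by blast
    \<comment> \<open>Gaussian elimination with pivot \<open>a k j\<close>: one equation and one
      unknown disappear. The value of \<open>d k\<close> below restores equation
      \<open>j\<close>.\<close>
    let ?b = "\<lambda>i j'. a i j' - a i j / a k j * a k j'"
    have "card T < card (I - {k})" using insert.prems insert.hyps k by simp
    then obtain c where c: "\<exists>i\<in>I - {k}. c i \<noteq> 0" "\<forall>j'\<in>T. (\<Sum>i\<in>I - {k}. c i * ?b i j') = 0"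
      using insert.IH[of "I - {k}" ?b] insert.prems by auto
    define d where "d = c(k := - (\<Sum>i\<in>I - {k}. c i * a i j) / a k j)"
    have sum_d: "(\<Sum>i\<in>I. d i * a i j') = d k * a k j' + (\<Sum>i\<in>I - {k}. c i * a i j')" for j'
      using sum.remove[OF insert.prems(1) k(1), of "\<lambda>i. d i * a i j'"]
      by (simp add: d_def cong: sum.cong_simp)
    have "(\<Sum>i\<in>I. d i * a i j) = 0" unfolding sum_d using k(2) by (simp add: d_def)
    moreover have "(\<Sum>i\<in>I. d i * a i j') = 0" if "j' \<in> T" for j'
    proof -
      have "(\<Sum>i\<in>I - {k}. c i * a i j') = (\<Sum>i\<in>I - {k}. c i * a i j) / a k j * a k j'"
        using c(2) that by (simp add: right_diff_distrib sum_subtractf sum_distrib_left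
            sum_divide_distrib mult_ac)
      then show ?thesis unfolding sum_d by (simp add: d_def)
    qed
    moreover have "\<exists>i\<in>I. d i \<noteq> 0" using c(1) by (auto simp: d_def)
    ultimately show ?thesis by blast
  qed
qed

text \<open>Each exponent is bounded separately, not the total degree: the exponent vectors form a
  \<open>PiE\<close> with \<open>(K + 1) ^ M\<close> elements, and bounds add under
  multiplication.\<close>

definition box_poly :: "nat \<Rightarrow> nat \<Rightarrow> ((nat \<Rightarrow> complex) \<Rightarrow> complex) set"
  where "box_poly M K = {f. \<exists>a. \<forall>x. f x =
    (\<Sum>e\<in>PiE {..<M} (\<lambda>_. {..K}). a e * (\<Prod>i<M. x i ^ e i))}"

lemma box_poly_add:
  assumes "f \<in> box_poly M K" and "g \<in> box_poly M K"
  shows "(\<lambda>x. f x + g x) \<in> box_poly M K"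
proof -
  obtain a b where "\<forall>x. f x = (\<Sum>e\<in>PiE {..<M} (\<lambda>_. {..K}). a e * (\<Prod>i<M. x i ^ e i))"
    "\<forall>x. g x = (\<Sum>e\<in>PiE {..<M} (\<lambda>_. {..K}). b e * (\<Prod>i<M. x i ^ e i))"
    using assms unfolding box_poly_def by auto
  then show ?thesis unfolding box_poly_def
    by (auto intro!: exI[of _ "\<lambda>e. a e + b e"] simp: sum.distrib ring_distribs)
qed

lemma box_poly_scale:
  assumes "f \<in> box_poly M K"
  shows "(\<lambda>x. c * f x) \<in> box_poly M K"
proof -
  obtain a where "\<forall>x. f x = (\<Sum>e\<in>PiE {..<M} (\<lambda>_. {..K}). a e * (\<Prod>i<M. x i ^ e i))"
    using assms unfolding box_poly_def by auto
  then show ?thesis unfolding box_poly_def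
    by (auto intro!: exI[of _ "\<lambda>e. c * a e"] simp: sum_distrib_left mult_ac)
qed

lemma box_poly_monomial:
  assumes "\<And>i. i < M \<Longrightarrow> e i \<le> K"
  shows "(\<lambda>x. \<Prod>i<M. x i ^ e i) \<in> box_poly M K"
proof -
  let ?e = "restrict e {..<M}"
  have e: "?e \<in> PiE {..<M} (\<lambda>_. {..K})" using assms by auto
  have "(\<Sum>e'\<in>PiE {..<M} (\<lambda>_. {..K}). (if e' = ?e then 1 else 0) * (\<Prod>i<M. x i ^ e' i))
    = (\<Prod>i<M. x i ^ e i)" for x :: "nat \<Rightarrow> complex"
  proof -
    have "(\<Sum>e'\<in>PiE {..<M} (\<lambda>_. {..K}). (if e' = ?e then 1 else 0) * (\<Prod>i<M. x i ^ e' i))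
      = (\<Sum>e'\<in>PiE {..<M} (\<lambda>_. {..K}). if e' = ?e then \<Prod>i<M. x i ^ e' i else 0)"
      by (rule sum.cong) auto
    also have "\<dots> = (\<Prod>i<M. x i ^ ?e i)"
      using e by (subst sum.delta) (auto intro: finite_PiE)
    finally show ?thesis by simp
  qed
  then show ?thesis unfolding box_poly_def
    by (auto intro!: exI[of _ "\<lambda>e'. if e' = ?e then 1 else 0"])
qed

lemma box_poly_sum:
  assumes "finite I" and "\<And>i. i \<in> I \<Longrightarrow> f i \<in> box_poly M K"
  shows "(\<lambda>x. \<Sum>i\<in>I. f i x) \<in> box_poly M K"
  using assms
proof (induction I rule: finite_induct)
  case empty
  show ?case unfolding box_poly_def by (auto intro!: exI[of _ "\<lambda>_. 0"])
next
  case (insert i I)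
  then show ?case by (auto intro!: box_poly_add)
qed

lemma box_poly_mult:
  assumes "f \<in> box_poly M K" and "g \<in> box_poly M L"
  shows "(\<lambda>x. f x * g x) \<in> box_poly M (K + L)"
proof -
  let ?P = "\<lambda>K. PiE {..<M} (\<lambda>_. {..K::nat})"
  obtain a b where ab: "\<forall>x. f x = (\<Sum>e\<in>?P K. a e * (\<Prod>i<M. x i ^ e i))"
    "\<forall>x. g x = (\<Sum>e\<in>?P L. b e * (\<Prod>i<M. x i ^ e i))"
    using assms unfolding box_poly_def by auto
  have "(\<lambda>x. f x * g x) = (\<lambda>x. \<Sum>e\<in>?P K. \<Sum>e'\<in>?P L. (a e * b e') * (\<Prod>i<M. x i ^ (e i + e' i)))"
    using ab by (simp add: sum_product power_add prod.distrib mult_ac)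
  moreover have "\<dots> \<in> box_poly M (K + L)"
    by (intro box_poly_sum box_poly_scale box_poly_monomial finite_PiE add_mono)
      (auto simp: PiE_iff)
  ultimately show ?thesis by simp
qed

lemma box_poly_const: "(\<lambda>_. c) \<in> box_poly M K"
  using box_poly_scale[OF box_poly_monomial[of M "\<lambda>_. 0" K], of c] by simp

lemma box_poly_mono:
  assumes "f \<in> box_poly M K" and "K \<le> L"
  shows "f \<in> box_poly M L"
  using box_poly_mult[OF assms(1) box_poly_const[of 1 M "L - K"]] assms(2) by simp

lemma polynomial_function_box:
  assumes "f \<in> polynomial_functions (nat_coords M)"
  shows "\<exists>K. f \<in> box_poly M K"
  using assms
proof induction
  case (const c)
  show ?case using box_poly_const by blast
next
  case (coord x)
  then obtain i where i: "i < M" "x = (\<lambda>x. x i)" by auto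
  have "(\<lambda>x. \<Prod>j<M. x j ^ (if j = i then 1 else 0)) \<in> box_poly M 1"
    by (rule box_poly_monomial) auto
  moreover have "(\<Prod>j<M. x j ^ (if j = i then 1 else 0)) = x i" for x :: "nat \<Rightarrow> complex"
    using i(1) by (subst prod.remove[of _ i]) auto
  ultimately show ?case using i(2) by auto
next
  case (add f g)
  then obtain K L where "f \<in> box_poly M K" "g \<in> box_poly M L" by auto
  then have "f \<in> box_poly M (max K L)" "g \<in> box_poly M (max K L)"
    by (auto intro: box_poly_mono)
  then show ?case using box_poly_add by blast
next
  case (mult f g)
  then show ?case using box_poly_mult by blast
qed

lemma box_poly_power:
  assumes "f \<in> box_poly M K"
  shows "(\<lambda>x. f x ^ n) \<in> box_poly M (n * K)"
  by (induction n) (auto intro: box_poly_const box_poly_mult assms)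

lemma box_poly_prod:
  assumes "\<And>i. i < m \<Longrightarrow> f i \<in> box_poly M K"
  shows "(\<lambda>x. \<Prod>i<m. f i x) \<in> box_poly M (m * K)"
  using assms
proof (induction m)
  case 0
  show ?case using box_poly_const by simp
next
  case (Suc m)
  then show ?case
    using box_poly_mult[of "\<lambda>x. \<Prod>i<m. f i x" M "m * K" "f m" K] by (simp add: add.commute)
qed

text \<open>The \<open>E ^ Suc M\<close> monomials in the given functions with exponents below \<open>E\<close> lie in a space
  of dimension \<open>O(E ^ M)\<close>.\<close>

lemma polynomial_functions_dependent:
  assumes "\<And>i. i < Suc M \<Longrightarrow> f i \<in> polynomial_functions (nat_coords M)"
  obtains E c e where "e \<in> PiE {..<Suc M} (\<lambda>_. {..<E})" "c e \<noteq> 0"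
    "\<And>x. (\<Sum>e\<in>PiE {..<Suc M} (\<lambda>_. {..<E}). c e * (\<Prod>i<Suc M. f i x ^ e i)) = 0"
proof -
  have "\<forall>i. i < Suc M \<longrightarrow> (\<exists>K. f i \<in> box_poly M K)"
    using assms polynomial_function_box by blast
  then obtain k where k: "\<And>i. i < Suc M \<Longrightarrow> f i \<in> box_poly M (k i)" by metis
  define D where "D = Max (k ` {..<Suc M})"
  have D: "f i \<in> box_poly M D" if "i < Suc M" for i
    using k[OF that] by (rule box_poly_mono) (use that in \<open>auto simp: D_def\<close>)
  \<comment> \<open>A product of \<open>Suc M\<close> powers with exponents below \<open>E\<close>
    has exponents at most \<open>K\<close>, and \<open>K + 1 \<le> (Suc M * D + 1) * E\<close>. So
    \<open>(K + 1) ^ M\<close> is at most \<open>(Suc M * D + 1) ^ M * E ^ M\<close>, which is below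
    \<open>E ^ Suc M\<close> because \<open>E\<close> exceeds
    \<open>(Suc M * D + 1) ^ M\<close>.\<close>
  define E where "E = (Suc M * D + 1) ^ M + 1"
  define K where "K = Suc M * (E * D)"
  let ?I = "PiE {..<Suc M} (\<lambda>_. {..<E})" and ?T = "PiE {..<M} (\<lambda>_. {..K})"
  have "(\<lambda>x. \<Prod>i<Suc M. f i x ^ e i) \<in> box_poly M K" if "e \<in> ?I" for e
    unfolding K_def
  proof (rule box_poly_prod)
    fix i assume i: "i < Suc M"
    then have "e i * D \<le> E * D" using PiE_mem[OF that, of i] by (intro mult_le_mono1) simp
    then show "(\<lambda>x. f i x ^ e i) \<in> box_poly M (E * D)"
      using box_poly_power[OF D[OF i]] box_poly_mono by blast
  qed
  then have "\<forall>e. \<exists>a. e \<in> ?I \<longrightarrow> (\<forall>x.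
      (\<Prod>i<Suc M. f i x ^ e i) = (\<Sum>t\<in>?T. a t * (\<Prod>i<M. x i ^ t i)))"
    unfolding box_poly_def by blast
  then obtain a where a: "\<And>e x. e \<in> ?I \<Longrightarrow>
      (\<Prod>i<Suc M. f i x ^ e i) = (\<Sum>t\<in>?T. a e t * (\<Prod>i<M. x i ^ t i))"
    using choice[of "\<lambda>e a. e \<in> ?I \<longrightarrow> (\<forall>x.
      (\<Prod>i<Suc M. f i x ^ e i) = (\<Sum>t\<in>?T. a t * (\<Prod>i<M. x i ^ t i)))"] by blast
  have "card ?T < card ?I"
  proof -
    have "K + 1 \<le> (Suc M * D + 1) * E" by (simp add: K_def E_def algebra_simps)
    then have "(K + 1) ^ M \<le> ((Suc M * D + 1) * E) ^ M" by (rule power_mono) simp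
    also have "\<dots> = (Suc M * D + 1) ^ M * E ^ M" by (rule power_mult_distrib)
    also have "\<dots> < E * E ^ M" by (rule mult_strict_right_mono) (simp_all add: E_def)
    finally show ?thesis by (simp add: card_PiE)
  qed
  then obtain c where c: "\<exists>e\<in>?I. c e \<noteq> 0" "\<forall>t\<in>?T. (\<Sum>e\<in>?I. c e * a e t) = 0"
    using homogeneous_system_nontrivial[of ?T ?I a] by (auto intro: finite_PiE)
  have "(\<Sum>e\<in>?I. c e * (\<Prod>i<Suc M. f i x ^ e i)) = 0" for x
  proof -
    have "(\<Sum>e\<in>?I. c e * (\<Prod>i<Suc M. f i x ^ e i))
        = (\<Sum>e\<in>?I. \<Sum>t\<in>?T. c e * a e t * (\<Prod>i<M. x i ^ t i))"
      by (rule sum.cong) (simp_all only: a sum_distrib_left mult.assoc)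
    also have "\<dots> = (\<Sum>t\<in>?T. (\<Sum>e\<in>?I. c e * a e t) * (\<Prod>i<M. x i ^ t i))"
      by (subst sum.swap) (simp add: sum_distrib_right)
    also have "\<dots> = 0" using c(2) by simp
    finally show ?thesis .
  qed
  then show thesis using that c(1) by blast
qed

section \<open>The dimension of a parametrized set\<close>

text \<open>\<open>\<phi>\<close> may leave \<open>S\<close>, as a matrix of free parameters may be
  singular; \<open>h\<close> cuts out an open set of parameters that land in \<open>S\<close>. In
  \<open>dense\<close>, \<open>q\<close> ranges over all parameters. All coordinate subspaces of the
  flag pass through \<open>b\<close>.\<close>

locale parametrization =
  fixes X :: "('a \<Rightarrow> complex) set" and S :: "'a set" and M :: nat
    and \<phi> :: "(nat \<Rightarrow> complex) \<Rightarrow> 'a" and h :: "(nat \<Rightarrow> complex) \<Rightarrow> complex"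
    and b :: "nat \<Rightarrow> complex"
  assumes coords: "x \<in> X \<Longrightarrow> (\<lambda>q. x (\<phi> q)) \<in> polynomial_functions (nat_coords M)"
    and dense: "\<lbrakk>F \<in> polynomial_functions X; \<And>q. F (\<phi> q) = 0; p \<in> S\<rbrakk> \<Longrightarrow> F p = 0"
    and h_poly: "h \<in> polynomial_functions (nat_coords M)"
    and h_base: "h b \<noteq> 0"
    and h_image: "h q \<noteq> 0 \<Longrightarrow> \<phi> q \<in> S"
begin

lemma compose_poly:
  "F \<in> polynomial_functions X \<Longrightarrow> (\<lambda>q. F (\<phi> q)) \<in> polynomial_functions (nat_coords M)"
  using polynomial_functions_compose coords by blast

text \<open>Parameters with \<open>h q \<noteq> 0\<close> are dense in the coordinate subspace: the
  line from \<open>q\<close> to \<open>b\<close> stays in it, and if \<open>F (\<phi> q)\<close>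
  were nonzero, then neither \<open>h\<close> nor the pullback of \<open>F\<close> would vanish at
  some point of that line.\<close>

lemma h_cancel:
  assumes F: "F \<in> polynomial_functions X"
    and 0: "\<And>q. \<lbrakk>\<And>i. i \<ge> d \<Longrightarrow> q i = b i; h q \<noteq> 0\<rbrakk> \<Longrightarrow> F (\<phi> q) = 0"
    and q: "\<And>i. i \<ge> d \<Longrightarrow> q i = b i"
  shows "F (\<phi> q) = 0"
proof (rule ccontr)
  assume "F (\<phi> q) \<noteq> 0"
  then obtain t where "F (\<phi> (\<lambda>i. q i + t * (b i - q i))) \<noteq> 0" "h (\<lambda>i. q i + t * (b i - q i)) \<noteq> 0"
    using nat_coords_line_domain[OF compose_poly[OF F] _ h_poly h_base] by blast
  then show False using 0[of "\<lambda>i. q i + t * (b i - q i)"] q by auto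
qed

text \<open>For \<open>d \<le> M\<close>, the closure in \<open>S\<close> of the image of the
  \<open>d\<close>-dimensional coordinate subspace through \<open>b\<close>. By
  \<open>h_cancel\<close> the condition over all parameters of this subspace is equivalent to that
  over those with \<open>h q \<noteq> 0\<close>, whose images lie in \<open>S\<close>.\<close>

definition stratum :: "nat \<Rightarrow> 'a set"
  where "stratum d = {p \<in> S. \<forall>F\<in>polynomial_functions X.
    (\<forall>q. (\<forall>i\<ge>d. q i = b i) \<longrightarrow> F (\<phi> q) = 0) \<longrightarrow> F p = 0}"

lemma image_in_stratum:
  assumes "\<And>i. i \<ge> d \<Longrightarrow> q i = b i" and "h q \<noteq> 0"
  shows "\<phi> q \<in> stratum d"
  using assms h_image by (auto simp: stratum_def)

lemma closedin_stratum: "closedin (zariski X S) (stratum d)"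
  unfolding closedin_zariski
  by (rule exI[of _ "{F \<in> polynomial_functions X. \<forall>q. (\<forall>i\<ge>d. q i = b i) \<longrightarrow> F (\<phi> q) = 0}"])
    (auto simp: stratum_def zero_locus_def)

text \<open>If neither factor vanishes on the stratum, each is nonzero at some parameter of the
  subspace, so both are nonzero at one point of the joining line. There the product vanishes by
  \<open>h_cancel\<close>, a contradiction.\<close>

lemma irreducible_stratum: "irreducible_space (zariski X (stratum d))"
proof (rule irreducible_zariskiI)
  show "stratum d \<noteq> {}" using image_in_stratum[of d b] h_base by auto
next
  fix f g
  assume fg: "f \<in> polynomial_functions X" "g \<in> polynomial_functions X" "\<forall>p\<in>stratum d. f p * g p = 0"
  have vanish: "\<forall>p\<in>stratum d. F p = 0"
    if "F \<in> polynomial_functions X" "\<And>q. (\<And>i. i \<ge> d \<Longrightarrow> q i = b i) \<Longrightarrow> F (\<phi> q) = 0" for F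
    using that by (auto simp: stratum_def)
  show "(\<forall>p\<in>stratum d. f p = 0) \<or> (\<forall>p\<in>stratum d. g p = 0)"
  proof (rule ccontr)
    assume "\<not> ?thesis"
    then obtain q r where q: "\<And>i. i \<ge> d \<Longrightarrow> q i = b i" "f (\<phi> q) \<noteq> 0"
      and r: "\<And>i. i \<ge> d \<Longrightarrow> r i = b i" "g (\<phi> r) \<noteq> 0"
      using vanish[OF fg(1)] vanish[OF fg(2)] by blast
    obtain t where t: "f (\<phi> (\<lambda>i. q i + t * (r i - q i))) \<noteq> 0"
        "g (\<phi> (\<lambda>i. q i + t * (r i - q i))) \<noteq> 0"
      using nat_coords_line_domain[OF compose_poly[OF fg(1)] q(2) compose_poly[OF fg(2)] r(2)]
      by blast
    have "(\<lambda>p. f p * g p) (\<phi> (\<lambda>i. q i + t * (r i - q i))) = 0"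
    proof (rule h_cancel[where d = d])
      show "(\<lambda>p. f p * g p) \<in> polynomial_functions X"
        using fg by (intro polynomial_functions.mult)
    qed (use q(1) r(1) fg(3) image_in_stratum in auto)
    then show False using t by simp
  qed
qed

lemma irreducible: "irreducible_space (zariski X S)"
proof -
  have "stratum M = S"
  proof
    show "S \<subseteq> stratum M"
    proof
      fix p assume p: "p \<in> S"
      have "F p = 0" if F: "F \<in> polynomial_functions X"
        and 0: "\<And>q. (\<And>i. i \<ge> M \<Longrightarrow> q i = b i) \<Longrightarrow> F (\<phi> q) = 0" for F
      proof (rule dense[OF F _ p])
        fix q
        \<comment> \<open>From index \<open>M\<close> on, \<open>q\<close> can be replaced by
          \<open>b\<close>, since the composite of \<open>F\<close> and \<open>\<phi>\<close> sees
          the first \<open>M\<close> values only.\<close>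
        let ?q = "\<lambda>i. if i < M then q i else b i"
        have "G q = G ?q" if "G \<in> polynomial_functions (nat_coords M)" for G
          using that by induction auto
        from this[OF compose_poly[OF F]] show "F (\<phi> q) = 0" using 0[of ?q] by simp
      qed
      then show "p \<in> stratum M" using p by (auto simp: stratum_def)
    qed
  qed (auto simp: stratum_def)
  then show ?thesis using irreducible_stratum[of M] by simp
qed

lemma chain_length_le:
  assumes Z: "\<And>i. i \<le> m \<Longrightarrow> closedin (zariski X S) (Z i)"
    "\<And>i. i \<le> m \<Longrightarrow> irreducible_space (subtopology (zariski X S) (Z i))"
    "\<And>i. i < m \<Longrightarrow> Z i \<subset> Z (Suc i)"
  shows "m \<le> M"
proof (rule ccontr)
  assume "\<not> m \<le> M"
  then have m: "Suc M \<le> m" by simp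
  have sub: "Z i \<subseteq> S" if "i \<le> m" for i using Z(1)[OF that] closedin_subset by force
  have irr: "irreducible_space (zariski X (Z i))" if "i \<le> m" for i
    using Z(2)[OF that] subtopology_zariski[OF sub[OF that]] by simp
  have "\<exists>g\<in>polynomial_functions X. (\<forall>p\<in>Z i. g p = 0) \<and> (\<exists>p\<in>Z (Suc i). g p \<noteq> 0)"
    if i: "i < m" for i
  proof -
    obtain F where F: "F \<subseteq> polynomial_functions X" "Z i = S \<inter> zero_locus F"
      using Z(1)[of i] i by (auto simp: closedin_zariski)
    obtain p where "p \<in> Z (Suc i)" "p \<notin> Z i" using Z(3)[OF i] by blast
    moreover from this have "p \<in> S" using sub[of "Suc i"] i by auto
    ultimately obtain f where "f \<in> F" "f p \<noteq> 0" using F(2) by (auto simp: zero_locus_def)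
    then show ?thesis using F \<open>p \<in> Z (Suc i)\<close> by (auto simp: zero_locus_def)
  qed
  then obtain g where g: "\<And>i. i < m \<Longrightarrow> g i \<in> polynomial_functions X"
    "\<And>i p. i < m \<Longrightarrow> p \<in> Z i \<Longrightarrow> g i p = 0" "\<And>i. i < m \<Longrightarrow> \<exists>p\<in>Z (Suc i). g i p \<noteq> 0"
    by metis
  \<comment> \<open>A relation among the pullbacks of \<open>g 0\<close>, ..., \<open>g M\<close>
    holds on the image of \<open>\<phi>\<close>, by density on all of \<open>S\<close>, and in
    particular on \<open>Z (Suc M)\<close>.\<close>
  obtain E c e where e: "e \<in> PiE {..<Suc M} (\<lambda>_. {..<E})" "c e \<noteq> 0"
    and 0: "\<And>q. (\<Sum>e\<in>PiE {..<Suc M} (\<lambda>_. {..<E}). c e * (\<Prod>i<Suc M. g i (\<phi> q) ^ e i)) = 0"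
  proof (rule polynomial_functions_dependent[of M "\<lambda>i q. g i (\<phi> q)"])
    show "(\<lambda>q. g i (\<phi> q)) \<in> polynomial_functions (nat_coords M)" if "i < Suc M" for i
      using compose_poly g(1) that m by simp
  qed blast
  have "c e = 0"
  proof (rule chain_monomials_independent[where m = "Suc M" and E = E and Z = Z and X = X
      and g = g and c = c and e = e])
    fix p assume "p \<in> Z (Suc M)"
    then have "p \<in> S" using sub[OF m] by blast
    then show "(\<Sum>e\<in>PiE {..<Suc M} (\<lambda>_. {..<E}). c e * (\<Prod>i<Suc M. g i p ^ e i)) = 0"
      by (rule dense[rotated 2]) (use 0 g(1) m in \<open>auto intro!: polynomial_functions_intros\<close>)
  next
    show "\<exists>p\<in>Z (Suc i). g i p \<noteq> 0" if "i < Suc M" for i using g(3) that m by simp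
    show "Z i \<subseteq> Z (Suc i)" if "i < Suc M" for i using Z(3)[of i] that m by auto
    show "g i p = 0" if "i < Suc M" "p \<in> Z i" for i p using g(2) that m by simp
  qed (use irr g(1) e(1) m in simp_all)
  with e(2) show False by simp
qed

text \<open>The hypothesis asks for a polynomial that tells the closures for \<open>d\<close> and
  \<open>Suc d\<close> apart. Its witness \<open>q\<close> may map outside \<open>S\<close>, since
  \<open>h_cancel\<close> moves it to a parameter with \<open>h\<close> nonzero; singular matrices
  are therefore admissible witnesses.\<close>

lemma krull_dim_eq:
  assumes "\<And>d. d < M \<Longrightarrow> \<exists>F\<in>polynomial_functions X.
    (\<forall>q. (\<forall>i\<ge>d. q i = b i) \<longrightarrow> F (\<phi> q) = 0) \<and> (\<exists>q. (\<forall>i>d. q i = b i) \<and> F (\<phi> q) \<noteq> 0)"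
  shows "krull_dim (zariski X S) = enat M"
  unfolding krull_dim_def
proof (rule antisym)
  show "Sup {enat m |m. \<exists>Z. (\<forall>i\<le>m. closedin (zariski X S) (Z i) \<and>
      irreducible_space (subtopology (zariski X S) (Z i))) \<and> (\<forall>i<m. Z i \<subset> Z (Suc i))} \<le> enat M"
  proof (rule Sup_least, clarify)
    fix m Z
    assume "\<forall>i\<le>m. closedin (zariski X S) (Z i) \<and>
      irreducible_space (subtopology (zariski X S) (Z i))" and "\<forall>i<m. Z i \<subset> Z (Suc i)"
    then have "m \<le> M" using chain_length_le[of m Z] by blast
    then show "enat m \<le> enat M" by simp
  qed
next
  have "stratum d \<subset> stratum (Suc d)" if d: "d < M" for d
  proof -
    obtain F q where F: "F \<in> polynomial_functions X" "\<And>q. (\<forall>i\<ge>d. q i = b i) \<Longrightarrow> F (\<phi> q) = 0"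
      and q: "\<And>i. i \<ge> Suc d \<Longrightarrow> q i = b i" "F (\<phi> q) \<noteq> 0"
      using assms[OF d] by (auto simp: Suc_le_eq)
    obtain r where r: "\<And>i. i \<ge> Suc d \<Longrightarrow> r i = b i" "h r \<noteq> 0" "F (\<phi> r) \<noteq> 0"
      using h_cancel[OF F(1), of "Suc d" q] q by blast
    have "\<phi> r \<in> stratum (Suc d)" using image_in_stratum r by blast
    moreover have "\<phi> r \<notin> stratum d" using F r(3) by (auto simp: stratum_def)
    moreover have "stratum d \<subseteq> stratum (Suc d)" by (auto simp: stratum_def)
    ultimately show ?thesis by blast
  qed
  moreover have "closedin (zariski X S) (stratum i)
      \<and> irreducible_space (subtopology (zariski X S) (stratum i))" for i
    using closedin_stratum irreducible_stratum
    by (simp add: subtopology_zariski stratum_def)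
  ultimately show "enat M \<le> Sup {enat m |m. \<exists>Z. (\<forall>i\<le>m. closedin (zariski X S) (Z i) \<and>
      irreducible_space (subtopology (zariski X S) (Z i))) \<and> (\<forall>i<m. Z i \<subset> Z (Suc i))}"
    by (intro Sup_upper) blast
qed

end

section \<open>Cyclic vectors\<close>

lemma pow_mat_Suc_left:
  assumes "(A :: 'a :: semiring_1 mat) \<in> carrier_mat k k"
  shows "A ^\<^sub>m Suc i = A * A ^\<^sub>m i"
proof (induction i)
  case 0
  show ?case using assms by simp
next
  case (Suc i)
  have "A ^\<^sub>m Suc (Suc i) = (A * A ^\<^sub>m i) * A" using Suc by simp
  also have "\<dots> = A * A ^\<^sub>m Suc i"
    using assoc_mult_mat[OF assms pow_carrier_mat[OF assms] assms] by simp
  finally show ?case .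
qed

lemma pow_mat_commute:
  assumes "(A :: 'a :: semiring_1 mat) \<in> carrier_mat k k" and "B \<in> carrier_mat k k" and "A * B = B * A"
  shows "A ^\<^sub>m i * B = B * A ^\<^sub>m i"
proof (induction i)
  case 0
  show ?case using assms by simp
next
  case (Suc i)
  note P = pow_carrier_mat[OF assms(1), of i]
  have "A ^\<^sub>m Suc i * B = A ^\<^sub>m i * (B * A)"
    using assms(3) by (simp add: assoc_mult_mat[OF P assms(1,2)])
  also have "\<dots> = B * A ^\<^sub>m i * A" using Suc by (simp add: assoc_mult_mat[OF P assms(2,1), symmetric])
  also have "\<dots> = B * A ^\<^sub>m Suc i" by (simp add: assoc_mult_mat[OF assms(2) P assms(1)])
  finally show ?case .
qed

text \<open>The determinant is nonzero iff \<open>v\<close> is a cyclic vector of \<open>A\<close>.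
  For fixed \<open>v\<close>, cyclicity thus becomes a Zariski open condition on
  \<open>A\<close>.\<close>

definition krylov :: "nat \<Rightarrow> complex mat \<Rightarrow> complex vec \<Rightarrow> complex mat"
  where "krylov k A v = mat k k (\<lambda>(r, i). (A ^\<^sub>m i *\<^sub>v v) $ r)"

lemma krylov_carrier [simp]: "krylov k A v \<in> carrier_mat k k"
  by (simp add: krylov_def)

lemma krylov_col:
  assumes "A \<in> carrier_mat k k" and "i < k"
  shows "col (krylov k A v) i = A ^\<^sub>m i *\<^sub>v v"
  using assms pow_carrier_mat[OF assms(1), of i]
  by (intro eq_vecI) (simp_all add: krylov_def)

text \<open>A format for Jordan matrices without a list of blocks: \<open>\<beta>\<close> holds the
  eigenvalues, and the zeros of \<open>\<sigma>\<close> mark the ends of the blocks.\<close>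

definition bidiagonal :: "nat \<Rightarrow> (nat \<Rightarrow> complex) \<Rightarrow> (nat \<Rightarrow> complex) \<Rightarrow> complex mat"
  where "bidiagonal k \<beta> \<sigma> = mat k k (\<lambda>(i, j). if i = j then \<beta> i else if j = Suc i then \<sigma> i else 0)"

lemma bidiagonal_carrier [simp]: "bidiagonal k \<beta> \<sigma> \<in> carrier_mat k k"
  by (simp add: bidiagonal_def)

lemma jordan_matrix_bidiagonal:
  "\<exists>\<beta> \<sigma>. jordan_matrix n_as = bidiagonal (sum_list (map fst n_as)) \<beta> \<sigma> \<and>
    (\<forall>i. Suc i < sum_list (map fst n_as) \<longrightarrow> \<sigma> i \<noteq> 0 \<longrightarrow> \<beta> i = \<beta> (Suc i))"
proof (induction n_as)
  case Nil
  have "jordan_matrix [] = bidiagonal 0 (\<lambda>_. 0) (\<lambda>_. 0)"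
    by (rule eq_matI) (simp_all add: bidiagonal_def)
  then show ?case by auto
next
  case (Cons na n_as)
  obtain n a where na: "na = (n, a)" by force
  let ?m = "sum_list (map fst n_as)"
  obtain \<beta> \<sigma> where J: "jordan_matrix n_as = bidiagonal ?m \<beta> \<sigma>"
    and eq: "\<And>i. Suc i < ?m \<Longrightarrow> \<sigma> i \<noteq> 0 \<Longrightarrow> \<beta> i = \<beta> (Suc i)" using Cons by blast
  let ?\<beta> = "\<lambda>i. if i < n then a else \<beta> (i - n)"
  let ?\<sigma> = "\<lambda>i. if Suc i < n then 1 else if i < n then 0 else \<sigma> (i - n)"
  have "jordan_matrix (na # n_as) = bidiagonal (n + ?m) ?\<beta> ?\<sigma>"
    unfolding na jordan_matrix_Cons J
    by (rule eq_matI) (auto simp: bidiagonal_def Suc_diff_le)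
  moreover have "?\<beta> i = ?\<beta> (Suc i)" if "Suc i < n + ?m" "?\<sigma> i \<noteq> 0" for i
    using that eq[of "i - n"] by (auto simp: Suc_diff_le split: if_splits)
  ultimately show ?case using na by (intro exI[of _ ?\<beta>] exI[of _ ?\<sigma>]) auto
qed

lemma bidiagonal_mult_index:
  assumes M: "M \<in> carrier_mat k n" and ij: "i < k" "j < n"
  shows "(bidiagonal k \<beta> \<sigma> * M) $$ (i, j)
    = \<beta> i * M $$ (i, j) + (if Suc i < k then \<sigma> i * M $$ (Suc i, j) else 0)"
proof -
  have "(bidiagonal k \<beta> \<sigma> * M) $$ (i, j)
      = (\<Sum>l\<in>{0..<k}. (if i = l then \<beta> i else if l = Suc i then \<sigma> i else 0) * M $$ (l, j))"
    using M ij by (simp add: bidiagonal_def scalar_prod_def)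
  also have "\<dots> = (\<Sum>l\<in>{0..<k}. (if l = i then \<beta> i * M $$ (i, j) else 0)
      + (if l = Suc i then \<sigma> i * M $$ (Suc i, j) else 0))"
    by (rule sum.cong) auto
  also have "\<dots> = \<beta> i * M $$ (i, j) + (if Suc i < k then \<sigma> i * M $$ (Suc i, j) else 0)"
    using ij by (simp add: sum.distrib)
  finally show ?thesis .
qed

text \<open>On each block, a maximal run of nonzero \<open>\<sigma> i\<close>, both matrices are a
  scalar plus the same nilpotent matrix.\<close>

lemma bidiagonal_commute:
  assumes "\<And>i. \<lbrakk>Suc i < k; \<sigma> i \<noteq> 0\<rbrakk> \<Longrightarrow> \<beta> i = \<beta> (Suc i) \<and> \<gamma> i = \<gamma> (Suc i)"
  shows "bidiagonal k \<beta> \<sigma> * bidiagonal k \<gamma> \<sigma> = bidiagonal k \<gamma> \<sigma> * bidiagonal k \<beta> \<sigma>"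
proof (rule eq_matI)
  fix i j
  assume "i < dim_row (bidiagonal k \<gamma> \<sigma> * bidiagonal k \<beta> \<sigma>)"
    and "j < dim_col (bidiagonal k \<gamma> \<sigma> * bidiagonal k \<beta> \<sigma>)"
  then have ij: "i < k" "j < k" by (simp_all add: bidiagonal_def)
  show "(bidiagonal k \<beta> \<sigma> * bidiagonal k \<gamma> \<sigma>) $$ (i, j) = (bidiagonal k \<gamma> \<sigma> * bidiagonal k \<beta> \<sigma>) $$ (i, j)"
    unfolding bidiagonal_mult_index[OF bidiagonal_carrier ij]
    using assms[of i] ij by (cases "\<sigma> i = 0") (auto simp: bidiagonal_def)
qed (simp_all add: bidiagonal_def)

lemma bidiagonal_transpose_mult_index:
  assumes y: "y \<in> carrier_vec k" and j: "j < k"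
  shows "((bidiagonal k \<beta> \<sigma>)\<^sup>T *\<^sub>v y) $ j
    = \<beta> j * y $ j + (if j = 0 then 0 else \<sigma> (j - 1) * y $ (j - 1))"
proof -
  have "((bidiagonal k \<beta> \<sigma>)\<^sup>T *\<^sub>v y) $ j
      = (\<Sum>l\<in>{0..<k}. (if l = j then \<beta> l else if j = Suc l then \<sigma> l else 0) * y $ l)"
    using y j by (simp add: bidiagonal_def scalar_prod_def)
  also have "\<dots> = (\<Sum>l\<in>{0..<k}. (if l = j then \<beta> j * y $ j else 0)
      + (if l = j - 1 then if j = 0 then 0 else \<sigma> (j - 1) * y $ (j - 1) else 0))"
    by (rule sum.cong) auto
  also have "\<dots> = \<beta> j * y $ j + (if j = 0 then 0 else \<sigma> (j - 1) * y $ (j - 1))"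
    using j by (simp add: sum.distrib)
  finally show ?thesis .
qed

text \<open>The sum \<open>v\<close> of the last basis vectors of the blocks is cyclic if different blocks have
  different eigenvalues: a left eigenvector is supported at the last index of a single block.\<close>

lemma bidiagonal_left_eigenvector:
  fixes \<beta> \<sigma> :: "nat \<Rightarrow> complex"
  assumes block: "\<And>i. \<lbrakk>Suc i < k; \<sigma> i \<noteq> 0\<rbrakk> \<Longrightarrow> \<beta> i = \<beta> (Suc i)"
    and distinct: "\<And>i j. \<lbrakk>i < j; j < k; \<sigma> i = 0\<rbrakk> \<Longrightarrow> \<beta> i \<noteq> \<beta> j"
    and y: "y \<in> carrier_vec k" "y \<noteq> 0\<^sub>v k"
    and eigen: "(bidiagonal k \<beta> \<sigma>)\<^sup>T *\<^sub>v y = c \<cdot>\<^sub>v y"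
  defines "v \<equiv> vec k (\<lambda>i. if Suc i < k \<and> \<sigma> i \<noteq> 0 then 0 else 1)"
  shows "y \<bullet> v \<noteq> 0"
proof -
  have eq: "\<beta> j * y $ j + (if j = 0 then 0 else \<sigma> (j - 1) * y $ (j - 1)) = c * y $ j" if "j < k" for j
    using bidiagonal_transpose_mult_index[OF y(1) that, of \<beta> \<sigma>] that y(1) unfolding eigen by simp
  \<comment> \<open>If \<open>\<beta> (Suc j)\<close> differed from \<open>c\<close>, the equation
    at \<open>Suc j\<close> would make both \<open>\<sigma> j\<close> and \<open>y $ j\<close>
    nonzero; but \<open>j\<close> then belongs to the same block, where the eigenvalue is
    \<open>c\<close> by induction.\<close>
  have val: "\<beta> j = c" if "j < k" "y $ j \<noteq> 0" for j
    using that
  proof (induction j)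
    case 0
    then show ?case using eq[of 0] by simp
  next
    case (Suc j)
    show ?case
    proof (rule ccontr)
      assume "\<beta> (Suc j) \<noteq> c"
      then have "\<sigma> j \<noteq> 0 \<and> y $ j \<noteq> 0" using eq[of "Suc j"] Suc.prems by auto
      then show False using Suc block[of j] \<open>\<beta> (Suc j) \<noteq> c\<close> by auto
    qed
  qed
  have last: "\<sigma> j = 0" if "Suc j < k" "y $ j \<noteq> 0" for j
  proof (rule ccontr)
    assume "\<sigma> j \<noteq> 0"
    then have "\<beta> (Suc j) = c" using block[of j] val[of j] that by simp
    then show False using eq[of "Suc j"] that \<open>\<sigma> j \<noteq> 0\<close> by simp
  qed
  obtain j where j: "j < k" "y $ j \<noteq> 0"
    using y by (metis eq_vecI carrier_vecD index_zero_vec)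
  have other: "y $ i = 0" if "i < k" "i \<noteq> j" for i
  proof (rule ccontr)
    assume "y $ i \<noteq> 0"
    then show False
      using distinct[of i j] distinct[of j i] last[of i] last[of j] val[of i] val[of j] j that
      by (cases "i < j") auto
  qed
  have "y \<bullet> v = (\<Sum>i\<in>{0..<k}. if i = j then y $ j else 0)"
    unfolding scalar_prod_def v_def dim_vec using other last[of j] j by (intro sum.cong) auto
  also have "\<dots> = y $ j" using j by simp
  finally show ?thesis using j by simp
qed

text \<open>A nonzero \<open>y\<close> orthogonal to all columns of the Krylov matrix is multiplied
  in turn by the transpose of the bidiagonal matrix minus \<open>\<beta> 0\<close>,
  \<open>\<beta> 1\<close>, and so on. The transpose is lower triangular, so step \<open>r\<close>
  kills entry \<open>r\<close> and keeps the earlier zeros, at the price of one orthogonality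
  relation. The vector never becomes zero, as no left eigenvector is orthogonal to \<open>v\<close>;
  yet after \<open>k\<close> steps all its entries are zero.\<close>

lemma bidiagonal_cyclic:
  fixes \<beta> \<sigma> :: "nat \<Rightarrow> complex"
  assumes block: "\<And>i. \<lbrakk>Suc i < k; \<sigma> i \<noteq> 0\<rbrakk> \<Longrightarrow> \<beta> i = \<beta> (Suc i)"
    and distinct: "\<And>i j. \<lbrakk>i < j; j < k; \<sigma> i = 0\<rbrakk> \<Longrightarrow> \<beta> i \<noteq> \<beta> j"
  defines "v \<equiv> vec k (\<lambda>i. if Suc i < k \<and> \<sigma> i \<noteq> 0 then 0 else 1)"
  shows "det (krylov k (bidiagonal k \<beta> \<sigma>) v) \<noteq> 0"
proof
  let ?A = "bidiagonal k \<beta> \<sigma>"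
  let ?K = "krylov k ?A v"
  assume "det ?K = 0"
  then have "det (?K\<^sup>T) = 0" by (simp add: det_transpose[OF krylov_carrier])
  then obtain y where y: "y \<in> carrier_vec k" "y \<noteq> 0\<^sub>v k" "?K\<^sup>T *\<^sub>v y = 0\<^sub>v k"
    using det_0_iff_vec_prod_zero[of "?K\<^sup>T" k] by auto
  have v: "v \<in> carrier_vec k" by (simp add: v_def)
  have A: "?A ^\<^sub>m i \<in> carrier_mat k k" for i by (rule pow_carrier_mat) simp
  have start: "y \<bullet> (?A ^\<^sub>m i *\<^sub>v v) = 0" if "i < k" for i
  proof -
    have "col ?K i = ?A ^\<^sub>m i *\<^sub>v v" using that by (rule krylov_col[OF bidiagonal_carrier])
    then have "(?A ^\<^sub>m i *\<^sub>v v) \<bullet> y = (?K\<^sup>T *\<^sub>v y) $ i"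
      using that by (simp add: krylov_def)
    also have "\<dots> = 0" using y(3) that by simp
    finally show ?thesis
      using comm_scalar_prod[OF y(1) mult_mat_vec_carrier[OF A v]] by simp
  qed
  have "\<exists>y. y \<in> carrier_vec k \<and> y \<noteq> 0\<^sub>v k \<and> (\<forall>j<r. y $ j = 0)
      \<and> (\<forall>i<k - r. y \<bullet> (?A ^\<^sub>m i *\<^sub>v v) = 0)" if "r \<le> k" for r
    using that
  proof (induction r)
    case 0
    show ?case using y start by auto
  next
    case (Suc r)
    then obtain y where y: "y \<in> carrier_vec k" "y \<noteq> 0\<^sub>v k" "\<forall>j<r. y $ j = 0"
      "\<forall>i<k - r. y \<bullet> (?A ^\<^sub>m i *\<^sub>v v) = 0" by auto
    let ?y = "?A\<^sup>T *\<^sub>v y - \<beta> r \<cdot>\<^sub>v y"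
    have Ay: "?A\<^sup>T *\<^sub>v y \<in> carrier_vec k" using y(1) by (simp add: mult_mat_vec_carrier[of _ k k])
    have y': "?y \<in> carrier_vec k" using y(1) Ay by simp
    have "?y \<noteq> 0\<^sub>v k"
    proof
      assume *: "?y = 0\<^sub>v k"
      have "?A\<^sup>T *\<^sub>v y = \<beta> r \<cdot>\<^sub>v y"
      proof (rule eq_vecI)
        fix i assume "i < dim_vec (\<beta> r \<cdot>\<^sub>v y)"
        then have i: "i < k" using y(1) by simp
        have "?y $ i = 0" unfolding * using i by simp
        then show "(?A\<^sup>T *\<^sub>v y) $ i = (\<beta> r \<cdot>\<^sub>v y) $ i" using i y(1) Ay by simp
      qed (use y(1) in \<open>simp add: bidiagonal_def\<close>)
      then have "y \<bullet> v \<noteq> 0"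
        unfolding v_def using block distinct y(1,2)
        by (intro bidiagonal_left_eigenvector[where \<beta> = \<beta> and \<sigma> = \<sigma> and c = "\<beta> r"]) auto
      moreover have "0 < k - r" using Suc.prems by simp
      then have "y \<bullet> (?A ^\<^sub>m 0 *\<^sub>v v) = 0" using y(4) by blast
      then have "y \<bullet> v = 0" using v by (simp add: bidiagonal_def)
      ultimately show False by simp
    qed
    moreover have "?y $ j = 0" if "j < Suc r" for j
    proof -
      have jk: "j < k" using that Suc.prems by simp
      have "?y $ j = (?A\<^sup>T *\<^sub>v y) $ j - \<beta> r * y $ j"
        using jk y(1) Ay by simp
      also have "\<dots> = 0"
        using that y(3) by (auto simp: bidiagonal_transpose_mult_index[OF y(1) jk] less_Suc_eq)
      finally show ?thesis .
    qed
    moreover have "?y \<bullet> (?A ^\<^sub>m i *\<^sub>v v) = 0" if "i < k - Suc r" for i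
    proof -
      let ?w = "?A ^\<^sub>m i *\<^sub>v v"
      have w: "?w \<in> carrier_vec k" by (rule mult_mat_vec_carrier[OF A v])
      have "?y \<bullet> ?w = (?A\<^sup>T *\<^sub>v y) \<bullet> ?w - \<beta> r * (y \<bullet> ?w)"
        using y(1) Ay w by (simp add: minus_scalar_prod_distrib[of _ k])
      also have "(?A\<^sup>T *\<^sub>v y) \<bullet> ?w = y \<bullet> (?A *\<^sub>v ?w)"
        using transpose_vec_mult_scalar[OF bidiagonal_carrier w y(1), of \<beta> \<sigma>] by simp
      also have "?A *\<^sub>v ?w = ?A ^\<^sub>m Suc i *\<^sub>v v"
        unfolding pow_mat_Suc_left[OF bidiagonal_carrier]
        using assoc_mult_mat_vec[OF bidiagonal_carrier A v] by simp
      also have "y \<bullet> \<dots> = 0"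
      proof -
        have "Suc i < k - r" using that by simp
        then show ?thesis using y(4) by blast
      qed
      also have "y \<bullet> ?w = 0"
      proof -
        have "i < k - r" using that by simp
        then show ?thesis using y(4) by blast
      qed
      finally show ?thesis by simp
    qed
    ultimately show ?case using y' by blast
  qed
  from this[of k] obtain y where "y \<in> carrier_vec k" "y \<noteq> 0\<^sub>v k" "\<forall>j<k. y $ j = 0" by auto
  then show False by (metis eq_vecI carrier_vecD index_zero_vec)
qed

lemma krylov_conjugate:
  assumes A: "A \<in> carrier_mat k k" and P: "P \<in> carrier_mat k k" and Q: "Q \<in> carrier_mat k k"
    and QP: "Q * P = 1\<^sub>m k" and v: "v \<in> carrier_vec k"
  shows "krylov k (P * A * Q) (P *\<^sub>v v) = P * krylov k A v"
proof -
  let ?B = "P * A * Q"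
  have B: "?B \<in> carrier_mat k k" using A P Q by simp
  have Ai: "A ^\<^sub>m i \<in> carrier_mat k k" for i by (rule pow_carrier_mat[OF A])
  have pow: "?B ^\<^sub>m i *\<^sub>v (P *\<^sub>v v) = P *\<^sub>v (A ^\<^sub>m i *\<^sub>v v)" for i
  proof (induction i)
    case 0
    show ?case using A P B v by simp
  next
    case (Suc i)
    let ?w = "A ^\<^sub>m i *\<^sub>v v"
    have w: "?w \<in> carrier_vec k" using mult_mat_vec_carrier[OF Ai v] .
    have "?B ^\<^sub>m Suc i *\<^sub>v (P *\<^sub>v v) = ?B *\<^sub>v (P *\<^sub>v ?w)"
      unfolding pow_mat_Suc_left[OF B]
      using assoc_mult_mat_vec[OF B pow_carrier_mat[OF B], of "P *\<^sub>v v" i] P v Suc by simp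
    also have "\<dots> = (?B * P) *\<^sub>v ?w" using assoc_mult_mat_vec[OF B P w] by simp
    also have "?B * P = P * A"
      using assoc_mult_mat[of "P * A" k k Q k P k] A P Q QP by simp
    also have "(P * A) *\<^sub>v ?w = P *\<^sub>v (A ^\<^sub>m Suc i *\<^sub>v v)"
      unfolding pow_mat_Suc_left[OF A]
      using assoc_mult_mat_vec[OF P A w] assoc_mult_mat_vec[OF A Ai v] by simp
    finally show ?case .
  qed
  show ?thesis
  proof (rule eq_matI)
    fix i j assume "i < dim_row (P * krylov k A v)" "j < dim_col (P * krylov k A v)"
    then have ij: "i < k" "j < k" using P by (simp_all add: krylov_def)
    have "krylov k ?B (P *\<^sub>v v) $$ (i, j) = (P *\<^sub>v (A ^\<^sub>m j *\<^sub>v v)) $ i"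
      unfolding krylov_def using ij by (simp add: pow)
    also have "\<dots> = (P * krylov k A v) $$ (i, j)"
      using ij P krylov_col[OF A ij(2), of v] carrier_matD[OF krylov_carrier, of k A v] by simp
    finally show "krylov k ?B (P *\<^sub>v v) $$ (i, j) = (P * krylov k A v) $$ (i, j)" .
  qed (use P in \<open>simp_all add: krylov_def\<close>)
qed

text \<open>In a Jordan basis of \<open>B\<close>, the blocks are kept and given pairwise distinct
  eigenvalues. The result still commutes with \<open>B\<close>, and the distinct eigenvalues provide
  a cyclic vector.\<close>

lemma exists_cyclic_commuting:
  assumes B: "(B :: complex mat) \<in> carrier_mat k k"
  obtains R v where "R \<in> carrier_mat k k" "v \<in> carrier_vec k" "R * B = B * R"
    "det (krylov k R v) \<noteq> 0"
proof -
  obtain n_as where "jordan_nf B n_as"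
    using char_poly_factorized[OF B] jordan_nf_exists[OF B] by blast
  then obtain P Q where PQ: "similar_mat_wit B (jordan_matrix n_as) P Q"
    unfolding jordan_nf_def similar_mat_def by blast
  let ?J = "jordan_matrix n_as"
  have P: "P \<in> carrier_mat k k" and Q: "Q \<in> carrier_mat k k" and J: "?J \<in> carrier_mat k k"
    and PQ1: "P * Q = 1\<^sub>m k" and QP: "Q * P = 1\<^sub>m k" and B_eq: "B = P * ?J * Q"
    using similar_mat_witD2[OF B PQ] by auto
  have k: "sum_list (map fst n_as) = k" using J by auto
  obtain \<beta> \<sigma> where J_eq: "?J = bidiagonal k \<beta> \<sigma>"
    and \<beta>: "\<And>i. \<lbrakk>Suc i < k; \<sigma> i \<noteq> 0\<rbrakk> \<Longrightarrow> \<beta> i = \<beta> (Suc i)"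
    using jordan_matrix_bidiagonal[of n_as] unfolding k by auto
  \<comment> \<open>\<open>\<gamma>\<close> numbers the blocks by counting the block ends before
    \<open>i\<close>: it is constant on a block and grows from one block to the next.\<close>
  define \<gamma> :: "nat \<Rightarrow> complex" where "\<gamma> i = of_nat (card {l. l < i \<and> \<sigma> l = 0})" for i
  have \<gamma>: "\<gamma> i = \<gamma> (Suc i)" if "\<sigma> i \<noteq> 0" for i
  proof -
    have "{l. l < Suc i \<and> \<sigma> l = 0} = {l. l < i \<and> \<sigma> l = 0}" using that less_Suc_eq by auto
    then show ?thesis by (simp add: \<gamma>_def)
  qed
  have \<gamma>_distinct: "\<gamma> i \<noteq> \<gamma> j" if "i < j" "\<sigma> i = 0" for i j
  proof -
    have "card {l. l < i \<and> \<sigma> l = 0} < card {l. l < j \<and> \<sigma> l = 0}"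
      by (rule psubset_card_mono) (use that in auto)
    then show ?thesis by (simp add: \<gamma>_def)
  qed
  let ?R = "bidiagonal k \<gamma> \<sigma>"
  let ?v = "vec k (\<lambda>i. if Suc i < k \<and> \<sigma> i \<noteq> 0 then 0 else 1)"
  have conj_mult: "(P * S * Q) * (P * T * Q) = P * (S * T) * Q"
    if S: "S \<in> carrier_mat k k" and T: "T \<in> carrier_mat k k" for S T
  proof -
    have "(P * S * Q) * (P * T * Q) = P * S * ((Q * P) * (T * Q))"
      using P Q S T by (simp add: assoc_mult_mat[of _ k k _ k _ k])
    also have "\<dots> = P * (S * T) * Q"
      using P Q S T unfolding QP by (simp add: assoc_mult_mat[of _ k k _ k _ k])
    finally show ?thesis .
  qed
  show thesis
  proof (rule that)
    show "P * ?R * Q \<in> carrier_mat k k"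
      by (rule mult_carrier_mat[OF mult_carrier_mat[OF P bidiagonal_carrier] Q])
    show "P *\<^sub>v ?v \<in> carrier_vec k" using P by simp
    show "P * ?R * Q * B = B * (P * ?R * Q)"
      unfolding B_eq J_eq conj_mult[OF bidiagonal_carrier bidiagonal_carrier]
      using bidiagonal_commute[of k \<sigma> \<gamma> \<beta>] \<beta> \<gamma> by simp
    have "det P * det Q = 1" using det_mult[OF P Q] unfolding PQ1 by simp
    then have "det P \<noteq> 0" by auto
    moreover have "det (krylov k ?R ?v) \<noteq> 0"
      using \<gamma> \<gamma>_distinct by (intro bidiagonal_cyclic) auto
    ultimately show "det (krylov k (P * ?R * Q) (P *\<^sub>v ?v)) \<noteq> 0"
      using krylov_conjugate[OF bidiagonal_carrier P Q QP, of ?v \<gamma> \<sigma>]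
      by (simp add: det_mult[OF P krylov_carrier])
  qed
qed

section \<open>Polynomials in a matrix\<close>

text \<open>Degrees below \<open>k\<close> suffice for the centralizer of a matrix with a cyclic
  vector, which has dimension \<open>k\<close>. They are the source of the summand \<open>k\<close>
  in the dimension of C(GL k).\<close>

definition mat_polynomial :: "nat \<Rightarrow> complex mat \<Rightarrow> (nat \<Rightarrow> complex) \<Rightarrow> complex mat"
  where "mat_polynomial k A c = mat k k (\<lambda>(r, s). \<Sum>i<k. c i * (A ^\<^sub>m i) $$ (r, s))"

lemma mat_polynomial_carrier [simp]: "mat_polynomial k A c \<in> carrier_mat k k"
  by (simp add: mat_polynomial_def)

lemma mat_polynomial_commute:
  assumes A: "A \<in> carrier_mat k k"
  shows "A * mat_polynomial k A c = mat_polynomial k A c * A"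
proof (rule eq_matI)
  fix r s
  assume "r < dim_row (mat_polynomial k A c * A)" and "s < dim_col (mat_polynomial k A c * A)"
  then have rs: "r < k" "s < k" using A by (simp_all add: mat_polynomial_def)
  have Ai: "A ^\<^sub>m i \<in> carrier_mat k k" for i by (rule pow_carrier_mat[OF A])
  have "(A * mat_polynomial k A c) $$ (r, s) = (\<Sum>l = 0..<k. \<Sum>i<k. c i * (A $$ (r, l) * (A ^\<^sub>m i) $$ (l, s)))"
    using A rs by (simp add: mat_polynomial_def scalar_prod_def sum_distrib_left mult_ac)
  also have "\<dots> = (\<Sum>i<k. c i * (A * A ^\<^sub>m i) $$ (r, s))"
    using A Ai rs by (subst sum.swap) (simp add: scalar_prod_def sum_distrib_left)
  also have "\<dots> = (\<Sum>i<k. c i * (A ^\<^sub>m i * A) $$ (r, s))"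
    using pow_mat_Suc_left[OF A] by simp
  also have "\<dots> = (\<Sum>l = 0..<k. \<Sum>i<k. c i * (A ^\<^sub>m i) $$ (r, l) * A $$ (l, s))"
    using A Ai rs by (subst sum.swap) (simp add: scalar_prod_def sum_distrib_left mult.assoc)
  also have "\<dots> = (mat_polynomial k A c * A) $$ (r, s)"
    using A rs by (simp add: mat_polynomial_def scalar_prod_def sum_distrib_right)
  finally show "(A * mat_polynomial k A c) $$ (r, s) = (mat_polynomial k A c * A) $$ (r, s)" .
qed (use A in \<open>simp_all add: mat_polynomial_def\<close>)

text \<open>The \<open>c i\<close> are the coordinates of \<open>B v\<close> in the basis
  \<open>v\<close>, \<open>A v\<close>, and so on. The difference of \<open>B\<close> and the
  resulting polynomial in \<open>A\<close> commutes with \<open>A\<close> and kills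
  \<open>v\<close>, hence kills the whole basis.\<close>

lemma commuting_cyclic_polynomial:
  assumes A: "A \<in> carrier_mat k k" and B: "B \<in> carrier_mat k k" and AB: "A * B = B * A"
    and v: "v \<in> carrier_vec k" and cyc: "det (krylov k A v) \<noteq> 0"
  obtains c where "B = mat_polynomial k A c"
proof -
  let ?K = "krylov k A v"
  have "?K \<in> Units (ring_mat TYPE(complex) k ())"
    by (rule det_non_zero_imp_unit[OF krylov_carrier cyc])
  then obtain K' where K': "K' \<in> carrier_mat k k" "?K * K' = 1\<^sub>m k"
    unfolding Units_def by (auto simp: ring_mat_def)
  have Ai: "A ^\<^sub>m i \<in> carrier_mat k k" for i by (rule pow_carrier_mat[OF A])
  define c where "c i = (K' *\<^sub>v (B *\<^sub>v v)) $ i" for i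
  let ?P = "mat_polynomial k A c"
  have Bv: "B *\<^sub>v v \<in> carrier_vec k" using B v by simp
  have P: "?P \<in> carrier_mat k k" by simp
  have Pv: "?P *\<^sub>v v = B *\<^sub>v v"
  proof (rule eq_vecI)
    fix r assume "r < dim_vec (B *\<^sub>v v)"
    then have r: "r < k" using B by simp
    have "(?P *\<^sub>v v) $ r = (\<Sum>s = 0..<k. \<Sum>i<k. c i * ((A ^\<^sub>m i) $$ (r, s) * v $ s))"
      using r v by (simp add: mat_polynomial_def scalar_prod_def sum_distrib_right mult.assoc)
    also have "\<dots> = (\<Sum>i<k. c i * (A ^\<^sub>m i *\<^sub>v v) $ r)"
      using r v carrier_matD[OF Ai] by (subst sum.swap) (simp add: scalar_prod_def sum_distrib_left)
    also have "\<dots> = (?K *\<^sub>v (K' *\<^sub>v (B *\<^sub>v v))) $ r"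
      using r K' by (simp add: c_def krylov_def scalar_prod_def mult.commute lessThan_atLeast0)
    also have "?K *\<^sub>v (K' *\<^sub>v (B *\<^sub>v v)) = B *\<^sub>v v"
      using assoc_mult_mat_vec[OF krylov_carrier K'(1) Bv, of A v] K'(2) Bv by simp
    finally show "(?P *\<^sub>v v) $ r = (B *\<^sub>v v) $ r" .
  qed (use B in \<open>simp add: mat_polynomial_def\<close>)
  let ?D = "B - ?P"
  have D: "?D \<in> carrier_mat k k" using P by (rule minus_carrier_mat)
  have AD: "A * ?D = ?D * A"
    using mult_minus_distrib_mat[OF A B P] minus_mult_distrib_mat[OF B P A] AB mat_polynomial_commute[OF A]
    by simp
  have Dv: "?D *\<^sub>v v = 0\<^sub>v k"
    using minus_mult_distrib_mat_vec[OF B P v] Pv Bv by simp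
  have DA: "?D *\<^sub>v (A ^\<^sub>m i *\<^sub>v v) = 0\<^sub>v k" for i
  proof -
    have "?D *\<^sub>v (A ^\<^sub>m i *\<^sub>v v) = (A ^\<^sub>m i * ?D) *\<^sub>v v"
      using assoc_mult_mat_vec[OF D Ai v] pow_mat_commute[OF A D AD] by simp
    also have "\<dots> = A ^\<^sub>m i *\<^sub>v 0\<^sub>v k" using assoc_mult_mat_vec[OF Ai D v] Dv by simp
    also have "\<dots> = 0\<^sub>v k"
      by (rule eq_vecI) (use carrier_matD[OF Ai[of i]] in \<open>simp_all add: scalar_prod_def\<close>)
    finally show ?thesis .
  qed
  have "?D * ?K = 0\<^sub>m k k"
  proof (rule eq_matI)
    fix r i assume "r < dim_row (0\<^sub>m k k)" "i < dim_col (0\<^sub>m k k)"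
    then have ri: "r < k" "i < k" by simp_all
    have "col ?K i = A ^\<^sub>m i *\<^sub>v v" using ri(2) by (rule krylov_col[OF A])
    then have "(?D * ?K) $$ (r, i) = (?D *\<^sub>v (A ^\<^sub>m i *\<^sub>v v)) $ r"
      using ri carrier_matD[OF D] carrier_matD[OF krylov_carrier, of k A v] by simp
    then show "(?D * ?K) $$ (r, i) = 0\<^sub>m k k $$ (r, i)" using DA ri by simp
  qed (use D in \<open>simp_all add: krylov_def mat_polynomial_def\<close>)
  then have "?D * (?K * K') = 0\<^sub>m k k"
    using assoc_mult_mat[OF D krylov_carrier K'(1), of A v] K'(1) by simp
  then have D0: "?D = 0\<^sub>m k k" unfolding K'(2) right_mult_one_mat[OF D] .
  have "B = ?P"
  proof (rule eq_matI)
    fix r s assume "r < dim_row ?P" "s < dim_col ?P"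
    then have "r < k" "s < k" by (simp_all add: mat_polynomial_def)
    then have "?D $$ (r, s) = B $$ (r, s) - ?P $$ (r, s)" "0\<^sub>m k k $$ (r, s) = (0 :: complex)"
      using carrier_matD[OF P] by simp_all
    then have "B $$ (r, s) - ?P $$ (r, s) = 0" unfolding D0 by simp
    then show "B $$ (r, s) = ?P $$ (r, s)" by simp
  qed (use B in \<open>simp_all add: mat_polynomial_def\<close>)
  then show thesis by (rule that)
qed

section \<open>Matrices with polynomial entries\<close>

definition polynomial_mat :: "('a \<Rightarrow> complex) set \<Rightarrow> nat \<Rightarrow> ('a \<Rightarrow> complex mat) \<Rightarrow> bool"
  where "polynomial_mat X k M \<longleftrightarrow> (\<forall>q. M q \<in> carrier_mat k k) \<and>
    (\<forall>i<k. \<forall>j<k. (\<lambda>q. M q $$ (i, j)) \<in> polynomial_functions X)"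

lemma polynomial_mat_const: "A \<in> carrier_mat k k \<Longrightarrow> polynomial_mat X k (\<lambda>_. A)"
  by (auto simp: polynomial_mat_def intro: polynomial_functions.const)

lemma polynomial_mat_mult:
  assumes "polynomial_mat X k M" and "polynomial_mat X k N"
  shows "polynomial_mat X k (\<lambda>q. M q * N q)"
proof -
  have "(M q * N q) $$ (i, j) = (\<Sum>l = 0..<k. M q $$ (i, l) * N q $$ (l, j))"
    if "i < k" "j < k" for i j q
    using assms that carrier_matD[of "M q" k k] carrier_matD[of "N q" k k]
    by (auto simp: polynomial_mat_def scalar_prod_def)
  then show ?thesis using assms unfolding polynomial_mat_def
    by (auto intro!: polynomial_functions_intros mult_carrier_mat)
qed

lemma polynomial_mat_pow:
  assumes "polynomial_mat X k M"
  shows "polynomial_mat X k (\<lambda>q. M q ^\<^sub>m i)"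
proof (induction i)
  case 0
  have "dim_row (M q) = k" for q using assms by (auto simp: polynomial_mat_def)
  then have "(\<lambda>q. M q ^\<^sub>m 0) = (\<lambda>_. 1\<^sub>m k)" by simp
  then show ?case by (simp add: polynomial_mat_const)
next
  case (Suc i)
  then show ?case using polynomial_mat_mult[OF Suc assms] by simp
qed

lemma polynomial_mat_det:
  assumes "polynomial_mat X k M"
  shows "(\<lambda>q. det (M q)) \<in> polynomial_functions X"
proof -
  have "det (M q) = (\<Sum>p\<in>{p. p permutes {0..<k}}. signof p * (\<Prod>i = 0..<k. M q $$ (i, p i)))" for q
    using assms by (intro det_def') (simp add: polynomial_mat_def)
  moreover have "(\<lambda>q. \<Sum>p\<in>{p. p permutes {0..<k}}. signof p * (\<Prod>i = 0..<k. M q $$ (i, p i)))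
      \<in> polynomial_functions X"
  proof (intro polynomial_functions_intros)
    fix p i assume "p \<in> {p. p permutes {0..<k}}" "i \<in> {0..<k}"
    then have "i < k" "p i < k" using permutes_in_image[of p "{0..<k}" i] by auto
    then show "(\<lambda>q. M q $$ (i, p i)) \<in> polynomial_functions X"
      using assms by (simp add: polynomial_mat_def)
  qed
  ultimately show ?thesis by simp
qed

lemma polynomial_mat_krylov:
  assumes "polynomial_mat X k M" and "v \<in> carrier_vec k"
  shows "polynomial_mat X k (\<lambda>q. krylov k (M q) v)"
proof -
  have "(M q ^\<^sub>m j *\<^sub>v v) $ i = (\<Sum>l = 0..<k. (M q ^\<^sub>m j) $$ (i, l) * v $ l)"
    if "i < k" for i j q
    using polynomial_mat_pow[OF assms(1), of j] that assms(2) carrier_matD[of "M q ^\<^sub>m j" k k]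
    by (auto simp: polynomial_mat_def scalar_prod_def)
  then show ?thesis using polynomial_mat_pow[OF assms(1)]
    by (auto simp: polynomial_mat_def krylov_def intro!: polynomial_functions_intros)
qed

lemma polynomial_mat_polynomial:
  assumes "polynomial_mat X k M" and "\<And>i. i < k \<Longrightarrow> c i \<in> polynomial_functions X"
  shows "polynomial_mat X k (\<lambda>q. mat_polynomial k (M q) (\<lambda>i. c i q))"
  using assms polynomial_mat_pow[OF assms(1)]
  by (auto simp: polynomial_mat_def mat_polynomial_def intro!: polynomial_functions_intros)

text \<open>The argument of Motzkin and Taussky: if \<open>R\<close> commutes with \<open>B\<close> and has a cyclic vector,
  then so does \<open>A + t (R - A)\<close> for all but finitely many \<open>t\<close>, and the matrices commuting with
  such a matrix are the polynomials in it.\<close>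

lemma commuting_pairs_dense:
  assumes A: "A \<in> carrier_mat k k" and B: "B \<in> carrier_mat k k" and AB: "A * B = B * A"
    and 0: "\<And>A' c. A' \<in> carrier_mat k k \<Longrightarrow> F A' (mat_polynomial k A' c) = 0"
    and F: "\<And>M. polynomial_mat {\<lambda>t. t} k M \<Longrightarrow> (\<lambda>t. F (M t) B) \<in> polynomial_functions {\<lambda>t. t}"
  shows "F A B = (0 :: complex)"
proof (rule ccontr)
  assume nz: "F A B \<noteq> 0"
  obtain R v where R: "R \<in> carrier_mat k k" "v \<in> carrier_vec k" "R * B = B * R"
    "det (krylov k R v) \<noteq> 0" using exists_cyclic_commuting[OF B] .
  define M where "M t = A + t \<cdot>\<^sub>m (R - A)" for t
  have M: "M t \<in> carrier_mat k k" for t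
    unfolding M_def by (intro add_carrier_mat smult_carrier_mat minus_carrier_mat A)
  have pM: "polynomial_mat {\<lambda>t. t} k M"
    unfolding polynomial_mat_def using M A R(1)
    by (auto simp: M_def intro!: polynomial_functions_intros intro: polynomial_functions.coord)
  have "M 0 = A" "M 1 = R" using A R(1) by (auto simp: M_def intro!: eq_matI)
  moreover obtain u where u: "F (M u) B \<noteq> 0" "det (krylov k (M u) v) \<noteq> 0"
    using polynomial_functions_id_domain[OF F[OF pM] polynomial_mat_det[OF
          polynomial_mat_krylov[OF pM R(2)]], of 0 1] calculation nz R(4) by auto
  \<comment> \<open>Both \<open>A\<close> and \<open>R\<close> commute with \<open>B\<close>, so the
    whole line through them does.\<close>
  have "M u * B = B * M u"
    using A B AB R(1,3) minus_carrier_mat[OF A, of R]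
    by (simp add: M_def add_mult_distrib_mat[of _ k k] mult_add_distrib_mat[of _ k k]
        minus_mult_distrib_mat[of _ k k] mult_minus_distrib_mat[of _ k k]
        mult_smult_assoc_mat[of _ k k] mult_smult_distrib[of _ k k])
  then obtain c where "B = mat_polynomial k (M u) c"
    using commuting_cyclic_polynomial[OF M B _ R(2) u(2)] by blast
  then show False using 0[OF M] u(1) by simp
qed

section \<open>Trace and unipotent matrices\<close>

definition mat_trace :: "complex mat \<Rightarrow> complex"
  where "mat_trace A = (\<Sum>i<dim_row A. A $$ (i, i))"

lemma mat_trace_mult:
  assumes "A \<in> carrier_mat n n" and "B \<in> carrier_mat n n"
  shows "mat_trace (A * B) = (\<Sum>i<n. \<Sum>j<n. A $$ (i, j) * B $$ (j, i))"
  using assms by (simp add: mat_trace_def scalar_prod_def lessThan_atLeast0)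

lemma mat_trace_comm:
  assumes "A \<in> carrier_mat n n" and "B \<in> carrier_mat n n"
  shows "mat_trace (A * B) = mat_trace (B * A)"
  unfolding mat_trace_mult[OF assms] mat_trace_mult[OF assms(2,1)]
  by (subst sum.swap) (simp add: mult.commute)

lemma mat_trace_add:
  assumes "A \<in> carrier_mat n n" and "B \<in> carrier_mat n n"
  shows "mat_trace (A + B) = mat_trace A + mat_trace B"
  using assms by (simp add: mat_trace_def sum.distrib)

lemma mat_trace_diff:
  assumes "A \<in> carrier_mat n n" and "B \<in> carrier_mat n n"
  shows "mat_trace (A - B) = mat_trace A - mat_trace B"
  using assms by (simp add: mat_trace_def sum_subtractf)

lemma nilpotent_eigenvalue:
  fixes N :: "complex mat"
  assumes N: "N \<in> carrier_mat n n" and nil: "N ^\<^sub>m m = 0\<^sub>m n n" and ev: "eigenvalue N c"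
  shows "c = 0"
proof (rule ccontr)
  assume c: "c \<noteq> 0"
  obtain v where v: "eigenvector N v c" using ev unfolding eigenvalue_def by blast
  then have vn: "v \<in> carrier_vec n" "v \<noteq> 0\<^sub>v n" using N by (simp_all add: eigenvector_def)
  have "c ^ m \<cdot>\<^sub>v v = 0\<^sub>m n n *\<^sub>v v"
    unfolding nil[symmetric] by (rule eigenvector_pow[OF N v, symmetric])
  also have "\<dots> = 0\<^sub>v n" using vn by (intro eq_vecI) (simp_all add: scalar_prod_def)
  finally have *: "c ^ m \<cdot>\<^sub>v v = 0\<^sub>v n" .
  have "v = 0\<^sub>v n"
  proof (rule eq_vecI)
    fix i assume "i < dim_vec (0\<^sub>v n)"
    then have i: "i < n" by simp
    have "(c ^ m \<cdot>\<^sub>v v) $ i = 0" unfolding * using i by simp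
    then show "v $ i = 0\<^sub>v n $ i" using i vn(1) c by simp
  qed (use vn in simp)
  then show False using vn by simp
qed

text \<open>The trace is that of a similar triangular matrix, whose diagonal entries are eigenvalues
  of \<open>N\<close> and so vanish.\<close>

lemma nilpotent_trace:
  assumes N: "N \<in> carrier_mat n n" and nil: "N ^\<^sub>m m = 0\<^sub>m n n"
  shows "mat_trace N = 0"
proof -
  obtain es where "char_poly N = (\<Prod>a\<leftarrow>es. [:- a, 1:])" using char_poly_factorized[OF N] by blast
  then obtain B where B: "B \<in> carrier_mat n n" "upper_triangular B" "similar_mat N B"
    using schur_decomposition_exists[OF N] by blast
  obtain P Q where PQ: "similar_mat_wit N B P Q" using B(3) unfolding similar_mat_def by blast
  have P: "P \<in> carrier_mat n n" and Q: "Q \<in> carrier_mat n n" and QP: "Q * P = 1\<^sub>m n"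
    and N_eq: "N = P * B * Q"
    using similar_mat_witD2[OF N PQ] by auto
  have "B $$ (i, i) = 0" if i: "i < n" for i
  proof (rule nilpotent_eigenvalue[OF N nil])
    have "B $$ (i, i) \<in> set (diag_mat B)" using i B(1) by (auto simp: diag_mat_def)
    then have "poly (char_poly B) (B $$ (i, i)) = 0"
      unfolding char_poly_upper_triangular[OF B(1,2)] by (rule linear_poly_root)
    then show "eigenvalue N (B $$ (i, i))"
      unfolding eigenvalue_root_char_poly[OF N] char_poly_similar[OF B(3)] .
  qed
  then have "mat_trace B = 0" using B(1) by (simp add: mat_trace_def)
  moreover have "mat_trace N = mat_trace (Q * (P * B))"
    unfolding N_eq by (rule mat_trace_comm[OF mult_carrier_mat[OF P B(1)] Q])
  moreover have "Q * (P * B) = B" using assoc_mult_mat[OF Q P B(1)] QP B(1) by simp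
  ultimately show ?thesis by simp
qed

lemma unipotent_trace:
  assumes "unipotent_mat n A"
  shows "mat_trace A = of_nat n"
proof -
  have A: "A \<in> carrier_mat n n" using assms by (simp add: unipotent_mat_def)
  obtain m where "(A - 1\<^sub>m n) ^\<^sub>m m = 0\<^sub>m n n" using assms by (auto simp: unipotent_mat_def)
  then have "mat_trace (A - 1\<^sub>m n) = 0" using nilpotent_trace[OF minus_carrier_mat[OF one_carrier_mat]] by blast
  then show ?thesis using mat_trace_diff[OF A one_carrier_mat] by (simp add: mat_trace_def)
qed

lemma mat_diag_pow: "mat_diag n f ^\<^sub>m m = mat_diag n (\<lambda>i. (f i :: complex) ^ m)"
  by (induction m) (simp_all add: mat_diag_dim[THEN carrier_matD(1)] mult.commute)

lemma unipotent_diagonal: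
  assumes A: "unipotent_mat n A" and diag: "\<And>i j. \<lbrakk>i < n; j < n; i \<noteq> j\<rbrakk> \<Longrightarrow> A $$ (i, j) = 0"
  shows "A = 1\<^sub>m n"
proof (rule eq_matI)
  have An: "A \<in> carrier_mat n n" using A by (simp add: unipotent_mat_def)
  then show "dim_row A = dim_row (1\<^sub>m n)" "dim_col A = dim_col (1\<^sub>m n)" by simp_all
  obtain m where m: "(A - 1\<^sub>m n) ^\<^sub>m m = 0\<^sub>m n n" using A by (auto simp: unipotent_mat_def)
  have "A - 1\<^sub>m n = mat_diag n (\<lambda>i. A $$ (i, i) - 1)"
    using An diag by (intro eq_matI) (auto simp: mat_diag_def)
  then have D: "mat_diag n (\<lambda>i. (A $$ (i, i) - 1) ^ m) = 0\<^sub>m n n"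
    using m by (simp add: mat_diag_pow)
  fix i j assume "i < dim_row (1\<^sub>m n)" "j < dim_col (1\<^sub>m n)"
  then have ij: "i < n" "j < n" by simp_all
  have "mat_diag n (\<lambda>i. (A $$ (i, i) - 1) ^ m) $$ (i, i) = 0" unfolding D using ij by simp
  then have "A $$ (i, i) = 1" using ij by (simp add: mat_diag_def)
  then show "A $$ (i, j) = 1\<^sub>m n $$ (i, j)" using ij diag[of i j] by (cases "i = j") auto
qed

section \<open>The groups \<open>GL k \<times> T b\<close>\<close>

lemma carrier_GL: "A \<in> carrier (GL n) \<longleftrightarrow> A \<in> carrier_mat n n \<and> det A \<noteq> 0"
  unfolding units_of_carrier
  using unit_imp_det_non_zero[of A n "()"] det_non_zero_imp_unit[of A n "()"]
  by (auto simp: Units_def ring_mat_simps)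

lemma one_GL: "\<one>\<^bsub>GL n\<^esub> = 1\<^sub>m n" and mult_GL: "A \<otimes>\<^bsub>GL n\<^esub> B = A * B"
  by (simp_all add: units_of_one units_of_mult ring_mat_simps)

lemma group_GL: "group (GL n)"
proof -
  interpret ring "ring_mat TYPE(complex) n ()" by (rule ring_mat)
  show ?thesis by (rule units_group)
qed

definition block_diag :: "nat \<Rightarrow> nat \<Rightarrow> complex mat \<Rightarrow> (nat \<Rightarrow> complex) \<Rightarrow> complex mat"
  where "block_diag k b A t = four_block_mat A (0\<^sub>m k b) (0\<^sub>m b k) (mat_diag b t)"

lemma block_diag_carrier:
  "A \<in> carrier_mat k k \<Longrightarrow> block_diag k b A t \<in> carrier_mat (k + b) (k + b)"
  by (simp add: block_diag_def)

lemma block_diag_index: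
  assumes "A \<in> carrier_mat k k" and "i < k + b" and "j < k + b"
  shows "block_diag k b A t $$ (i, j) =
    (if i < k \<and> j < k then A $$ (i, j) else if i = j then t (i - k) else 0)"
  using assms by (auto simp: block_diag_def mat_diag_def)

lemma block_diag_mult:
  assumes "A \<in> carrier_mat k k" and "B \<in> carrier_mat k k"
  shows "block_diag k b A s * block_diag k b B t = block_diag k b (A * B) (\<lambda>i. s i * t i)"
  unfolding block_diag_def
  using mult_four_block_mat[OF assms(1) zero_carrier_mat zero_carrier_mat mat_diag_dim
      assms(2) zero_carrier_mat zero_carrier_mat mat_diag_dim, of b s t] assms
  by (simp add: left_mult_zero_mat[OF mat_diag_dim] right_mult_zero_mat[OF mat_diag_dim])

lemma block_diag_one: "block_diag k b (1\<^sub>m k) (\<lambda>_. 1) = 1\<^sub>m (k + b)"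
  by (simp add: block_diag_def)

lemma block_diag_det:
  assumes "A \<in> carrier_mat k k"
  shows "det (block_diag k b A t) = det A * (\<Prod>i<b. t i)"
proof -
  have "upper_triangular (mat_diag b t)" by (auto simp: mat_diag_def)
  then have "det (mat_diag b t) = (\<Prod>i<b. t i)"
    using det_upper_triangular[of "mat_diag b t" b]
    by (simp add: prod_list_diag_prod mat_diag_def lessThan_atLeast0)
  then show ?thesis
    unfolding block_diag_def
    using det_four_block_mat_lower_left_zero[OF assms zero_carrier_mat refl mat_diag_dim, of b t]
    by simp
qed

lemma block_diag_eqI:
  assumes M: "M \<in> carrier_mat (k + b) (k + b)"
    and off: "\<And>i j. \<lbrakk>i < k + b; j < k + b; i \<noteq> j; \<not> (i < k \<and> j < k)\<rbrakk> \<Longrightarrow> M $$ (i, j) = 0"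
  shows "M = block_diag k b (mat k k (\<lambda>ij. M $$ ij)) (\<lambda>l. M $$ (k + l, k + l))"
proof (rule eq_matI)
  fix i j
  assume "i < dim_row (block_diag k b (mat k k (\<lambda>ij. M $$ ij)) (\<lambda>l. M $$ (k + l, k + l)))"
    and "j < dim_col (block_diag k b (mat k k (\<lambda>ij. M $$ ij)) (\<lambda>l. M $$ (k + l, k + l)))"
  then have ij: "i < k + b" "j < k + b" by (simp_all add: block_diag_def mat_diag_def)
  then show "M $$ (i, j) = block_diag k b (mat k k (\<lambda>ij. M $$ ij)) (\<lambda>l. M $$ (k + l, k + l)) $$ (i, j)"
    using off[of i j] by (subst block_diag_index) auto
qed (use M in \<open>simp_all add: block_diag_def mat_diag_def\<close>)

text \<open>The determinant is \<open>det A\<close> times the product of the \<open>t i\<close>, so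
  a single condition makes \<open>A\<close> invertible and all torus entries nonzero.\<close>

definition GL_torus :: "nat \<Rightarrow> nat \<Rightarrow> complex mat set"
  where "GL_torus k b = {block_diag k b A t | A t.
    A \<in> carrier_mat k k \<and> det (block_diag k b A t) \<noteq> 0}"

text \<open>These linear equations on the entries give closedness in \<open>GL (k + b)\<close> at
  once and test membership without exhibiting \<open>A\<close> and \<open>t\<close>.\<close>

lemma GL_torus_iff:
  "M \<in> GL_torus k b \<longleftrightarrow> M \<in> carrier (GL (k + b)) \<and>
    (\<forall>i<k + b. \<forall>j<k + b. i \<noteq> j \<longrightarrow> \<not> (i < k \<and> j < k) \<longrightarrow> M $$ (i, j) = 0)" (is "_ \<longleftrightarrow> ?R")
proof
  assume "M \<in> GL_torus k b"
  then show ?R by (auto simp: GL_torus_def carrier_GL block_diag_carrier block_diag_index)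
next
  assume R: ?R
  then have M: "M \<in> carrier_mat (k + b) (k + b)" "det M \<noteq> 0" by (auto simp: carrier_GL)
  have eq: "M = block_diag k b (mat k k (\<lambda>ij. M $$ ij)) (\<lambda>l. M $$ (k + l, k + l))"
    by (rule block_diag_eqI[OF M(1)]) (use R in auto)
  show "M \<in> GL_torus k b"
    unfolding GL_torus_def mem_Collect_eq
    by (rule exI[of _ "mat k k (\<lambda>ij. M $$ ij)"], rule exI[of _ "\<lambda>l. M $$ (k + l, k + l)"])
      (use eq M(2) in auto)
qed

lemma subgroup_GL_torus: "subgroup (GL_torus k b) (GL (k + b))"
proof
  show "GL_torus k b \<subseteq> carrier (GL (k + b))" by (auto simp: GL_torus_iff)
  show "\<one>\<^bsub>GL (k + b)\<^esub> \<in> GL_torus k b"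
    unfolding one_GL GL_torus_iff carrier_GL by simp
  fix M N assume M: "M \<in> GL_torus k b"
  then obtain A s where A: "A \<in> carrier_mat k k" "M = block_diag k b A s" "det M \<noteq> 0"
    by (auto simp: GL_torus_def)
  {
    assume "N \<in> GL_torus k b"
    then obtain B t where B: "B \<in> carrier_mat k k" "N = block_diag k b B t" "det N \<noteq> 0"
      by (auto simp: GL_torus_def)
    have "det (M * N) \<noteq> 0"
      using det_mult[of M "k + b" N] A B by (simp add: block_diag_carrier)
    then show "M \<otimes>\<^bsub>GL (k + b)\<^esub> N \<in> GL_torus k b"
      unfolding mult_GL GL_torus_def mem_Collect_eq A(2) B(2) block_diag_mult[OF A(1) B(1)]
      using mult_carrier_mat[OF A(1) B(1)] by blast
  }
  have s: "s i \<noteq> 0" if "i < b" for i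
    using A block_diag_det[OF A(1), of b s] that by auto
  have detA: "det A \<noteq> 0" using A block_diag_det[OF A(1), of b s] by auto
  then obtain A' where A': "A' \<in> carrier_mat k k" "A' * A = 1\<^sub>m k"
    using det_non_zero_imp_unit[OF A(1), of "()"] by (auto simp: Units_def ring_mat_simps)
  let ?N = "block_diag k b A' (\<lambda>i. inverse (s i))"
  have "?N * M = block_diag k b (A' * A) (\<lambda>i. inverse (s i) * s i)"
    unfolding A(2) by (rule block_diag_mult[OF A'(1) A(1)])
  also have "\<dots> = block_diag k b (1\<^sub>m k) (\<lambda>_. 1)"
    unfolding A'(2) using s detA
    by (intro eq_matI) (auto simp: block_diag_def mat_diag_def)
  finally have NM: "?N * M = 1\<^sub>m (k + b)" by (simp add: block_diag_one)
  have N: "?N \<in> carrier_mat (k + b) (k + b)" using A'(1) by (rule block_diag_carrier)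
  have M': "M \<in> carrier_mat (k + b) (k + b)" using A by (simp add: block_diag_carrier)
  have "det ?N * det M = 1" using det_mult[OF N M'] unfolding NM by simp
  then have detN: "det ?N \<noteq> 0" by auto
  have "inv\<^bsub>GL (k + b)\<^esub> M = ?N"
    by (rule group.inv_equality[OF group_GL])
      (use NM N M' A(3) detN in \<open>simp_all add: mult_GL one_GL carrier_GL\<close>)
  then show "inv\<^bsub>GL (k + b)\<^esub> M \<in> GL_torus k b"
    using detN A'(1) by (auto simp: GL_torus_def)
qed

lemma linear_algebraic_group_GL_torus: "linear_algebraic_group (k + b) (GL_torus k b)"
  unfolding linear_algebraic_group_def
proof
  let ?F = "{\<lambda>A. A $$ (i, j) | i j. i < k + b \<and> j < k + b \<and> i \<noteq> j \<and> \<not> (i < k \<and> j < k)}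
    :: (complex mat \<Rightarrow> complex) set"
  have "?F \<subseteq> polynomial_functions (mat_coords (k + b))"
    by (auto simp: mat_coords_def intro!: polynomial_functions.coord)
  moreover have "M \<in> GL_torus k b \<longleftrightarrow> M \<in> carrier (GL (k + b)) \<inter> zero_locus ?F" for M
    unfolding GL_torus_iff by (auto simp: zero_locus_def)
  ultimately show "closedin (zariski_mat (k + b) (carrier (GL (k + b)))) (GL_torus k b)"
    unfolding closedin_zariski by blast
qed (rule subgroup_GL_torus)

text \<open>The trivial subgroup is what puts the identity into the union that defines the unipotent
  radical.\<close>

lemma linear_algebraic_group_one: "linear_algebraic_group n {1\<^sub>m n}"
  unfolding linear_algebraic_group_def
proof
  show "subgroup {1\<^sub>m n} (GL n)"
    using group.triv_subgroup[OF group_GL, of n] unfolding one_GL .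
  define f :: "nat \<Rightarrow> nat \<Rightarrow> complex mat \<Rightarrow> complex"
    where "f i j A = A $$ (i, j) - (if i = j then 1 else 0)" for i j A
  let ?F = "{f i j | i j. i < n \<and> j < n}"
  have "f i j \<in> polynomial_functions (mat_coords n)" if "i < n" "j < n" for i j
    unfolding f_def
  proof (intro polynomial_functions_diff polynomial_functions.const)
    show "(\<lambda>A. A $$ (i, j)) \<in> polynomial_functions (mat_coords n)"
      using that by (auto simp: mat_coords_def intro!: polynomial_functions.coord)
  qed
  then have polys: "?F \<subseteq> polynomial_functions (mat_coords n)" by blast
  have "A = 1\<^sub>m n" if A: "A \<in> carrier (GL n) \<inter> zero_locus ?F" for A
  proof (rule eq_matI)
    have An: "A \<in> carrier_mat n n" using A by (simp add: carrier_GL)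
    then show "dim_row A = dim_row (1\<^sub>m n)" "dim_col A = dim_col (1\<^sub>m n)" by simp_all
    fix i j assume "i < dim_row (1\<^sub>m n)" "j < dim_col (1\<^sub>m n)"
    then have ij: "i < n" "j < n" by simp_all
    then have "f i j A = 0" using A unfolding zero_locus_def by blast
    then show "A $$ (i, j) = 1\<^sub>m n $$ (i, j)" using ij by (simp add: f_def)
  qed
  moreover have "1\<^sub>m n \<in> carrier (GL n) \<inter> zero_locus ?F"
  proof
    show "1\<^sub>m n \<in> carrier (GL n)" by (simp add: carrier_GL)
    show "1\<^sub>m n \<in> zero_locus ?F" by (auto simp: zero_locus_def f_def)
  qed
  ultimately have "{1\<^sub>m n} = carrier (GL n) \<inter> zero_locus ?F" by blast
  then show "closedin (zariski_mat n (carrier (GL n))) {1\<^sub>m n}"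
    unfolding closedin_zariski using polys by blast
qed

text \<open>For \<open>u\<close> in a normal unipotent subgroup and \<open>g = 1 + E\<close> with \<open>E\<close> an off-diagonal matrix unit,
  \<open>u g u g\<inverse>\<close> is unipotent. Comparing its trace with that of \<open>u\<^sup>2\<close> yields that the square of an
  off-diagonal entry of \<open>u\<close> is zero.\<close>

lemma normal_unipotent_trivial:
  assumes normal: "U \<lhd> (GL (k + b)\<lparr>carrier := GL_torus k b\<rparr>)"
    and unip: "\<And>A. A \<in> U \<Longrightarrow> unipotent_mat (k + b) A" and u: "u \<in> U"
  shows "u = 1\<^sub>m (k + b)"
proof (rule unipotent_diagonal[OF unip[OF u]])
  let ?n = "k + b"
  let ?H = "GL ?n\<lparr>carrier := GL_torus k b\<rparr>"
  have sub: "subgroup U ?H" using normal by (rule normal_imp_subgroup)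
  have grp: "group ?H" using normal.axioms(2)[OF normal] .
  have one_H: "\<one>\<^bsub>?H\<^esub> = 1\<^sub>m ?n" and mult_H: "A \<otimes>\<^bsub>?H\<^esub> B = A * B" for A B
    by (simp_all add: one_GL mult_GL)
  have UG: "U \<subseteq> GL_torus k b" using subgroup.subset[OF sub] by simp
  fix i j assume ij: "i < ?n" "j < ?n" "i \<noteq> j"
  show "u $$ (i, j) = 0"
  proof (cases "i < k \<and> j < k")
    case False
    then show ?thesis using u UG ij by (auto simp: GL_torus_iff)
  next
    case True
    \<comment> \<open>The one stands at the position transposed to \<open>(i, j)\<close>, so that
      the trace of \<open>(u * E) * (u * E)\<close> is the square of \<open>u $$ (i, j)\<close>.
      Since \<open>i\<close> and \<open>j\<close> are below \<open>k\<close>, \<open>1 + E\<close>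
      lies in the group.\<close>
    define E :: "complex mat" where "E = mat ?n ?n (\<lambda>(r, s). if r = j \<and> s = i then 1 else 0)"
    have E: "E \<in> carrier_mat ?n ?n" by (simp add: E_def)
    have uc: "u \<in> carrier_mat ?n ?n" using unip[OF u] by (simp add: unipotent_mat_def)
    let ?I = "1\<^sub>m ?n :: complex mat"
    let ?g = "?I + E" and ?g' = "?I - E"
    have EE: "E * E = 0\<^sub>m ?n ?n"
    proof (rule eq_matI)
      fix r s assume "r < dim_row (0\<^sub>m ?n ?n)" "s < dim_col (0\<^sub>m ?n ?n)"
      then have rs: "r < ?n" "s < ?n" by simp_all
      have "(E * E) $$ (r, s) = (\<Sum>l = 0..<?n. E $$ (r, l) * E $$ (l, s))"
        using rs E by (simp add: scalar_prod_def)
      also have "\<dots> = 0" using rs ij(3) by (intro sum.neutral) (auto simp: E_def)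
      finally show "(E * E) $$ (r, s) = 0\<^sub>m ?n ?n $$ (r, s)" using rs by simp
    qed (use E in auto)
    have g: "?g \<in> carrier_mat ?n ?n" and g': "?g' \<in> carrier_mat ?n ?n"
      using E by (auto intro: minus_carrier_mat)
    have inverse: "?g' * ?g = ?I"
    proof -
      have "?g' * ?g = ?I * ?g - E * ?g"
        by (rule minus_mult_distrib_mat[OF one_carrier_mat E g])
      also have "E * ?g = E * ?I + E * E" by (rule mult_add_distrib_mat[OF E one_carrier_mat E])
      finally show ?thesis using E EE by (intro eq_matI) auto
    qed
    have "det ?g' * det ?g = 1" using det_mult[OF g' g] inverse by simp
    then have "det ?g \<noteq> 0" "det ?g' \<noteq> 0" by auto
    moreover have "?g $$ (r, s) = 0" "?g' $$ (r, s) = 0"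
      if "r < ?n" "s < ?n" "r \<noteq> s" "\<not> (r < k \<and> s < k)" for r s
      using that True by (auto simp: E_def)
    ultimately have gG: "?g \<in> GL_torus k b" "?g' \<in> GL_torus k b"
      using g g' by (auto simp: GL_torus_iff carrier_GL)
    have "inv\<^bsub>?H\<^esub> ?g = ?g'"
      by (rule group.inv_equality[OF grp]) (use gG inverse in \<open>simp_all add: one_GL mult_GL\<close>)
    then have "?g * u * ?g' \<in> U"
      using normal.inv_op_closed2[OF normal, of ?g u] gG u unfolding mult_H by simp
    then have "u * (?g * u * ?g') \<in> U"
      using subgroup.m_closed[OF sub u] unfolding mult_H by blast
    moreover have "u * (?g * u * ?g') = (u + u * E) * (u - u * E)"
    proof -
      have "u * (?g * u * ?g') = (u * ?g) * (u * ?g')"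
        using uc g g' by (simp add: assoc_mult_mat[of _ ?n ?n _ ?n _ ?n])
      also have "u * ?g = u + u * E" using mult_add_distrib_mat[OF uc one_carrier_mat E] uc by simp
      also have "u * ?g' = u - u * E" using mult_minus_distrib_mat[OF uc one_carrier_mat E] uc by simp
      finally show ?thesis .
    qed
    ultimately have "mat_trace ((u + u * E) * (u - u * E)) = of_nat ?n"
      using unipotent_trace[OF unip] by simp
    moreover have "mat_trace (u * u) = of_nat ?n"
      using unipotent_trace[OF unip] subgroup.m_closed[OF sub u u] unfolding mult_H by simp
    \<comment> \<open>The mixed terms \<open>u * (u * E)\<close> and \<open>(u * E) * u\<close>
      occur with opposite signs and have equal traces.\<close>
    moreover have "mat_trace ((u + u * E) * (u - u * E))
        = mat_trace (u * u) - mat_trace ((u * E) * (u * E))"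
    proof -
      let ?V = "u * E"
      have V: "?V \<in> carrier_mat ?n ?n" using uc E by simp
      note mc = mult_carrier_mat[of _ ?n ?n _ ?n]
      have "(u + ?V) * (u - ?V) = u * (u - ?V) + ?V * (u - ?V)"
        by (rule add_mult_distrib_mat[OF uc V minus_carrier_mat[OF V]])
      also have "\<dots> = (u * u - u * ?V) + (?V * u - ?V * ?V)"
        by (simp only: mult_minus_distrib_mat[OF uc uc V] mult_minus_distrib_mat[OF V uc V])
      also have "mat_trace \<dots> = mat_trace (u * u) - mat_trace (u * ?V)
          + (mat_trace (?V * u) - mat_trace (?V * ?V))"
        using mc[OF uc uc] mc[OF uc V] mc[OF V uc] mc[OF V V]
        by (simp only: mat_trace_add[of _ ?n] mat_trace_diff[of _ ?n] minus_carrier_mat)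
      finally show ?thesis using mat_trace_comm[OF uc V] by simp
    qed
    moreover have "mat_trace ((u * E) * (u * E)) = u $$ (i, j) * u $$ (i, j)"
    proof -
      have V: "(u * E) $$ (r, s) = (if s = i then u $$ (r, j) else 0)" if "r < ?n" "s < ?n" for r s
      proof -
        have "(u * E) $$ (r, s) = (\<Sum>l = 0..<?n. u $$ (r, l) * E $$ (l, s))"
          using that uc E by (simp add: scalar_prod_def)
        also have "\<dots> = (\<Sum>l = 0..<?n. if l = j then if s = i then u $$ (r, j) else 0 else 0)"
          using that by (intro sum.cong) (auto simp: E_def)
        finally show ?thesis using ij by simp
      qed
      have "mat_trace ((u * E) * (u * E)) = (\<Sum>r<?n. \<Sum>s<?n. (u * E) $$ (r, s) * (u * E) $$ (s, r))"
        using uc E by (intro mat_trace_mult) auto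
      also have "\<dots> = (\<Sum>r<?n. \<Sum>s<?n. if s = i then if r = i then u $$ (i, j) * u $$ (i, j) else 0 else 0)"
        by (intro sum.cong refl) (auto simp: V)
      also have "\<dots> = u $$ (i, j) * u $$ (i, j)" using ij by simp
      finally show ?thesis .
    qed
    ultimately show ?thesis by simp
  qed
qed

lemma reductive_GL_torus: "reductive (k + b) (GL_torus k b)"
proof -
  let ?n = "k + b"
  let ?H = "GL ?n\<lparr>carrier := GL_torus k b\<rparr>"
  interpret H: group ?H
    using subgroup.subgroup_is_group[OF subgroup_GL_torus group_GL] .
  have "{\<one>\<^bsub>?H\<^esub>} \<lhd> ?H"
  proof (unfold H.normal_inv_iff, intro conjI ballI)
    show "subgroup {\<one>\<^bsub>?H\<^esub>} ?H" by (rule H.triv_subgroup)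
    fix x h assume x: "x \<in> carrier ?H" and "h \<in> {\<one>\<^bsub>?H\<^esub>}"
    then have "h = \<one>\<^bsub>?H\<^esub>" by blast
    then show "x \<otimes>\<^bsub>?H\<^esub> h \<otimes>\<^bsub>?H\<^esub> inv\<^bsub>?H\<^esub> x \<in> {\<one>\<^bsub>?H\<^esub>}"
      by (simp only: H.r_one[OF x] H.r_inv[OF x] singleton_iff)
  qed
  then have "{1\<^sub>m ?n} \<lhd> ?H" by (simp add: one_GL)
  moreover have "connected_alg_group ?n {1\<^sub>m ?n}"
    unfolding connected_alg_group_def
    by (intro irreducible_imp_connected_space irreducible_zariskiI) auto
  moreover have "unipotent_mat ?n (1\<^sub>m ?n)"
    unfolding unipotent_mat_def by (auto intro!: exI[of _ 1] eq_matI)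
  ultimately have "1\<^sub>m ?n \<in> unipotent_radical ?n (GL_torus k b)"
    unfolding unipotent_radical_def using linear_algebraic_group_one[of ?n] by blast
  moreover have "u = 1\<^sub>m ?n" if "u \<in> unipotent_radical ?n (GL_torus k b)" for u
    using that normal_unipotent_trivial unfolding unipotent_radical_def by blast
  ultimately show ?thesis unfolding reductive_def by blast
qed

section \<open>Dimensions\<close>

text \<open>If \<open>F\<close> recovers \<open>q d\<close> once all later parameters sit at the
  base point, then \<open>F - b d\<close> vanishes on the smaller subspace, and raising
  \<open>b d\<close> by one gives a nonzero value.\<close>

lemma (in parametrization) separating_coordinate:
  assumes F: "F \<in> polynomial_functions X"
    and eq: "\<And>q. (\<forall>i>d. q i = b i) \<Longrightarrow> F (\<phi> q) = q d"
  shows "\<exists>F\<in>polynomial_functions X. (\<forall>q. (\<forall>i\<ge>d. q i = b i) \<longrightarrow> F (\<phi> q) = 0)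
    \<and> (\<exists>q. (\<forall>i>d. q i = b i) \<and> F (\<phi> q) \<noteq> 0)"
proof (intro bexI conjI allI impI exI)
  show "(\<lambda>p. F p - b d) \<in> polynomial_functions X"
    by (intro polynomial_functions_diff polynomial_functions.const F)
  fix q assume "\<forall>i\<ge>d. q i = b i"
  then show "F (\<phi> q) - b d = 0" using eq[of q] by simp
next
  let ?q = "b(d := b d + 1)"
  show "?q i = b i" if "d < i" for i using that by simp
  have "F (\<phi> ?q) = ?q d" by (rule eq) simp
  then show "F (\<phi> ?q) - b d \<noteq> 0" by simp
qed

lemma polynomial_mat_compose:
  assumes "polynomial_mat X k M"
    and "\<And>x. x \<in> X \<Longrightarrow> (\<lambda>q. x (\<phi> q)) \<in> polynomial_functions Y"
  shows "polynomial_mat Y k (\<lambda>q. M (\<phi> q))"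
  unfolding polynomial_mat_def
proof (intro conjI allI impI)
  show "M (\<phi> q) \<in> carrier_mat k k" for q using assms(1) by (simp add: polynomial_mat_def)
  fix i j assume "i < k" "j < k"
  then have "(\<lambda>p. M p $$ (i, j)) \<in> polynomial_functions X"
    using assms(1) by (simp add: polynomial_mat_def)
  from polynomial_functions_compose[OF this assms(2)]
  show "(\<lambda>q. M (\<phi> q) $$ (i, j)) \<in> polynomial_functions Y" .
qed

lemma mat_coords_compose:
  assumes "polynomial_mat Y n M" and "x \<in> mat_coords n"
  shows "(\<lambda>q. x (M q)) \<in> polynomial_functions Y"
  using assms by (auto simp: mat_coords_def polynomial_mat_def)

lemma mat_pair_coords_compose:
  assumes "polynomial_mat Y n M" and "polynomial_mat Y n N" and "x \<in> mat_pair_coords n"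
  shows "(\<lambda>q. x (M q, N q)) \<in> polynomial_functions Y"
  using assms mat_coords_compose by (auto simp: mat_pair_coords_def)

lemma mat_coord_polynomial:
  "i < n \<Longrightarrow> j < n \<Longrightarrow> (\<lambda>A. A $$ (i, j)) \<in> polynomial_functions (mat_coords n)"
  by (rule polynomial_functions.coord) (auto simp: mat_coords_def)

lemma mat_pair_coord_polynomial:
  assumes "i < n" and "j < n"
  shows "(\<lambda>p. fst p $$ (i, j)) \<in> polynomial_functions (mat_pair_coords n)"
    and "(\<lambda>p. snd p $$ (i, j)) \<in> polynomial_functions (mat_pair_coords n)"
proof -
  have "(\<lambda>A. A $$ (i, j)) \<in> mat_coords n" using assms by (auto simp: mat_coords_def)
  then have "(\<lambda>p. fst p $$ (i, j)) \<in> mat_pair_coords n" "(\<lambda>p. snd p $$ (i, j)) \<in> mat_pair_coords n"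
    unfolding mat_pair_coords_def by (auto intro: exI[of _ "\<lambda>A. A $$ (i, j)"])
  then show "(\<lambda>p. fst p $$ (i, j)) \<in> polynomial_functions (mat_pair_coords n)"
    "(\<lambda>p. snd p $$ (i, j)) \<in> polynomial_functions (mat_pair_coords n)"
    by (auto intro: polynomial_functions.coord)
qed

section \<open>Coordinates on \<open>GL_torus\<close>\<close>

definition coord_mat :: "nat \<Rightarrow> (nat \<Rightarrow> complex) \<Rightarrow> complex mat"
  where "coord_mat k q = mat k k (\<lambda>(i, j). q (i * k + j))"

lemma coord_mat_carrier [simp]: "coord_mat k q \<in> carrier_mat k k"
  by (simp add: coord_mat_def)

lemma coord_index_less: "i < k \<Longrightarrow> j < k \<Longrightarrow> i * k + j < k * (k :: nat)"
proof -
  assume "i < k" "j < k"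
  then have "i * k + j < Suc i * k" by simp
  also have "\<dots> \<le> k * k" using \<open>i < k\<close> by (intro mult_le_mono1) simp
  finally show ?thesis .
qed

lemma polynomial_mat_coord: "k * k \<le> M \<Longrightarrow> polynomial_mat (nat_coords M) k (coord_mat k)"
  unfolding polynomial_mat_def using coord_index_less
  by (fastforce simp: coord_mat_def intro: nat_coord_polynomial)

definition GL_torus_param :: "nat \<Rightarrow> nat \<Rightarrow> (nat \<Rightarrow> complex) \<Rightarrow> complex mat"
  where "GL_torus_param k b q = block_diag k b (coord_mat k q) (\<lambda>l. q (k * k + l))"

text \<open>The parameters of the identity matrix. The value 1 at every index from
  \<open>k * k\<close> on covers the torus entries and is reused for the second matrix of a
  commuting pair.\<close>

definition GL_torus_base :: "nat \<Rightarrow> nat \<Rightarrow> complex"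
  where "GL_torus_base k i = (if i < k * k \<and> i div k \<noteq> i mod k then 0 else 1)"

lemma polynomial_mat_block_diag:
  assumes "polynomial_mat X k M" and "\<And>l. l < b \<Longrightarrow> t l \<in> polynomial_functions X"
  shows "polynomial_mat X (k + b) (\<lambda>q. block_diag k b (M q) (\<lambda>l. t l q))"
  unfolding polynomial_mat_def
proof (intro conjI allI impI)
  have M: "M q \<in> carrier_mat k k" for q using assms(1) by (simp add: polynomial_mat_def)
  then show "block_diag k b (M q) (\<lambda>l. t l q) \<in> carrier_mat (k + b) (k + b)" for q
    by (rule block_diag_carrier)
  fix i j assume ij: "i < k + b" "j < k + b"
  show "(\<lambda>q. block_diag k b (M q) (\<lambda>l. t l q) $$ (i, j)) \<in> polynomial_functions X"
  proof (cases "i < k \<and> j < k")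
    case True
    then show ?thesis
      using assms(1) by (simp add: block_diag_index[OF M ij] polynomial_mat_def)
  next
    case False
    then have "(\<lambda>q. block_diag k b (M q) (\<lambda>l. t l q) $$ (i, j)) = (if i = j then t (i - k) else (\<lambda>_. 0))"
      by (auto simp: block_diag_index[OF M ij])
    then show ?thesis
      using False assms(2)[of "i - k"] ij by (auto intro: polynomial_functions.const)
  qed
qed

lemma polynomial_mat_GL_torus_param:
  "k * k + b \<le> M \<Longrightarrow> polynomial_mat (nat_coords M) (k + b) (GL_torus_param k b)"
  unfolding GL_torus_param_def
  by (intro polynomial_mat_block_diag polynomial_mat_coord nat_coord_polynomial) auto

lemma block_diag_mem:
  "A \<in> carrier_mat k k \<Longrightarrow> det (block_diag k b A t) \<noteq> 0 \<Longrightarrow> block_diag k b A t \<in> GL_torus k b"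
  unfolding GL_torus_def by blast

lemma GL_torus_param_mem: "det (GL_torus_param k b q) \<noteq> 0 \<Longrightarrow> GL_torus_param k b q \<in> GL_torus k b"
  unfolding GL_torus_param_def by (rule block_diag_mem[OF coord_mat_carrier])

lemma block_diag_cong: "(\<And>l. l < b \<Longrightarrow> s l = t l) \<Longrightarrow> block_diag k b A s = block_diag k b A t"
  unfolding block_diag_def mat_diag_def by (intro arg_cong[where f = "four_block_mat _ _ _"] cong_mat) auto

lemma coord_mat_cong:
  assumes "\<And>i. i < k * k \<Longrightarrow> q i = r i"
  shows "coord_mat k q = coord_mat k r"
  unfolding coord_mat_def using assms coord_index_less by (intro cong_mat) auto

lemma GL_torus_param_cong:
  assumes "\<And>i. i < k * k + b \<Longrightarrow> q i = r i"
  shows "GL_torus_param k b q = GL_torus_param k b r"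
proof -
  have "coord_mat k q = coord_mat k r" using assms by (intro coord_mat_cong) auto
  then show ?thesis unfolding GL_torus_param_def using assms by (auto intro: block_diag_cong)
qed

lemma coord_mat_surj:
  assumes "A \<in> carrier_mat k k"
  shows "coord_mat k (\<lambda>i. A $$ (i div k, i mod k)) = A"
  using assms by (intro eq_matI) (auto simp: coord_mat_def)

lemma coord_mat_base: "coord_mat k (GL_torus_base k) = 1\<^sub>m k"
  using coord_index_less by (intro eq_matI) (auto simp: coord_mat_def GL_torus_base_def)

lemma GL_torus_param_base: "GL_torus_param k b (GL_torus_base k) = 1\<^sub>m (k + b)"
  unfolding GL_torus_param_def coord_mat_base block_diag_one[symmetric]
  by (rule block_diag_cong) (simp add: GL_torus_base_def)

lemma GL_torus_param_surj:
  assumes "A \<in> GL_torus k b"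
  obtains q where "A = GL_torus_param k b q"
proof -
  obtain B t where B: "B \<in> carrier_mat k k" "A = block_diag k b B t"
    using assms by (auto simp: GL_torus_def)
  let ?q = "\<lambda>i. if i < k * k then B $$ (i div k, i mod k) else t (i - k * k)"
  have "coord_mat k ?q = coord_mat k (\<lambda>i. B $$ (i div k, i mod k))" by (rule coord_mat_cong) simp
  then have "A = GL_torus_param k b ?q"
    unfolding GL_torus_param_def B(2) coord_mat_surj[OF B(1)] by simp
  then show thesis by (rule that)
qed

definition coord_pos :: "nat \<Rightarrow> nat \<Rightarrow> nat \<times> nat"
  where "coord_pos k d = (if d < k * k then (d div k, d mod k) else (k + (d - k * k), k + (d - k * k)))"

lemma coord_pos_less:
  assumes "d < k * k + b" and "coord_pos k d = (i, j)"
  shows "i < k + b \<and> j < k + b"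
proof (cases "d < k * k")
  case True
  then have "k > 0" by (cases k) auto
  then show ?thesis
    using True assms less_mult_imp_div_less[of d k k] mod_less_divisor[of k d]
    by (auto simp: coord_pos_def)
next
  case False
  then show ?thesis using assms by (auto simp: coord_pos_def)
qed

lemma GL_torus_param_coord:
  assumes "d < k * k + b"
  shows "GL_torus_param k b q $$ coord_pos k d = q d"
proof (cases "d < k * k")
  case True
  then have "k > 0" by (cases k) auto
  then have dk: "d div k < k" "d mod k < k"
    using True less_mult_imp_div_less[of d k k] by simp_all
  have "GL_torus_param k b q $$ (d div k, d mod k) = coord_mat k q $$ (d div k, d mod k)"
    unfolding GL_torus_param_def
    using dk block_diag_index[OF coord_mat_carrier dk[THEN trans_less_add1]] by simp
  also have "\<dots> = q d" using dk by (simp add: coord_mat_def)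
  finally show ?thesis using True by (simp add: coord_pos_def)
next
  case False
  then obtain l where "d = k * k + l" by (metis le_iff_add not_less)
  then show ?thesis
    using assms by (simp add: coord_pos_def GL_torus_param_def block_diag_index[OF coord_mat_carrier])
qed

lemma parametrization_GL_torus:
  "parametrization (mat_coords (k + b)) (GL_torus k b) (k * k + b) (GL_torus_param k b)
    (\<lambda>q. det (GL_torus_param k b q)) (GL_torus_base k)"
proof
  note poly = polynomial_mat_GL_torus_param[OF order_refl, of k b]
  show "(\<lambda>q. x (GL_torus_param k b q)) \<in> polynomial_functions (nat_coords (k * k + b))"
    if "x \<in> mat_coords (k + b)" for x
    using mat_coords_compose[OF poly that] .
  show "(\<lambda>q. det (GL_torus_param k b q)) \<in> polynomial_functions (nat_coords (k * k + b))"
    by (rule polynomial_mat_det[OF poly])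
  show "F p = 0" if "\<And>q. F (GL_torus_param k b q) = 0" "p \<in> GL_torus k b" for F p
    using GL_torus_param_surj[OF that(2)] that(1) by metis
qed (simp_all add: GL_torus_param_base GL_torus_param_mem)

lemma connected_GL_torus: "connected_alg_group (k + b) (GL_torus k b)"
  unfolding connected_alg_group_def
  by (rule irreducible_imp_connected_space[OF parametrization.irreducible[OF parametrization_GL_torus]])

lemma krull_dim_GL_torus: "krull_dim (zariski_mat (k + b) (GL_torus k b)) = enat (k * k + b)"
proof -
  interpret parametrization "mat_coords (k + b)" "GL_torus k b" "k * k + b" "GL_torus_param k b"
    "\<lambda>q. det (GL_torus_param k b q)" "GL_torus_base k"
    by (rule parametrization_GL_torus)
  show ?thesis
  proof (rule krull_dim_eq)
    fix d assume d: "d < k * k + b"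
    obtain i j where ij: "coord_pos k d = (i, j)" by force
    then have "i < k + b" "j < k + b" using coord_pos_less[OF d] by auto
    then show "\<exists>F\<in>polynomial_functions (mat_coords (k + b)).
      (\<forall>q. (\<forall>i\<ge>d. q i = GL_torus_base k i) \<longrightarrow> F (GL_torus_param k b q) = 0) \<and>
      (\<exists>q. (\<forall>i>d. q i = GL_torus_base k i) \<and> F (GL_torus_param k b q) \<noteq> 0)"
      using GL_torus_param_coord[OF d, unfolded ij]
      by (intro separating_coordinate[where F = "\<lambda>A. A $$ (i, j)"] mat_coord_polynomial)
  qed
qed

text \<open>The two matrices get consecutive stretches of \<open>D\<close> parameters each, so the
  square of the group is treated as one more parametrized set, directly in the coordinates of
  pairs.\<close>

lemma krull_dim_GL_torus_pairs:
  "krull_dim (zariski_mat_pair (k + b) (GL_torus k b \<times> GL_torus k b)) = enat (2 * (k * k + b))"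
proof -
  define D where "D = k * k + b"
  let ?n = "k + b"
  let ?\<psi> = "GL_torus_param k b"
  let ?s = "\<lambda>q i. q (D + i) :: complex"
  let ?\<phi> = "\<lambda>q. (?\<psi> q, ?\<psi> (?s q))"
  let ?h = "\<lambda>q. det (?\<psi> q) * det (?\<psi> (?s q))"
  let ?b = "\<lambda>i. if i < D then GL_torus_base k i else GL_torus_base k (i - D)"
  have poly1: "polynomial_mat (nat_coords (2 * D)) ?n ?\<psi>"
    by (rule polynomial_mat_GL_torus_param) (simp add: D_def)
  have poly2: "polynomial_mat (nat_coords (2 * D)) ?n (\<lambda>q. ?\<psi> (?s q))"
    by (rule polynomial_mat_compose[OF polynomial_mat_GL_torus_param[of k b D], where \<phi> = ?s])
      (auto simp: D_def intro!: nat_coord_polynomial)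
  interpret parametrization "mat_pair_coords ?n" "GL_torus k b \<times> GL_torus k b" "2 * D" ?\<phi> ?h ?b
  proof
    show "(\<lambda>q. x (?\<phi> q)) \<in> polynomial_functions (nat_coords (2 * D))"
      if "x \<in> mat_pair_coords ?n" for x
      using mat_pair_coords_compose[OF poly1 poly2 that] .
    show "?h \<in> polynomial_functions (nat_coords (2 * D))"
      by (intro polynomial_functions.mult polynomial_mat_det[OF poly1] polynomial_mat_det[OF poly2])
    show "?\<phi> q \<in> GL_torus k b \<times> GL_torus k b" if "?h q \<noteq> 0" for q
      using that GL_torus_param_mem by auto
    have "?\<psi> ?b = ?\<psi> (GL_torus_base k)" by (rule GL_torus_param_cong) (simp add: D_def)
    then show "?h ?b \<noteq> 0" by (simp add: GL_torus_param_base)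
    show "F p = 0" if F: "\<And>q. F (?\<phi> q) = 0" and p: "p \<in> GL_torus k b \<times> GL_torus k b" for F p
    proof -
      obtain q r where qr: "fst p = ?\<psi> q" "snd p = ?\<psi> r"
        using p GL_torus_param_surj by (metis mem_Times_iff)
      let ?q = "\<lambda>i. if i < D then q i else r (i - D)"
      have "?\<psi> ?q = ?\<psi> q" by (rule GL_torus_param_cong) (simp add: D_def)
      then have p_eq: "p = ?\<phi> ?q" using qr by (simp add: prod_eq_iff)
      show ?thesis unfolding p_eq by (rule F[of ?q])
    qed
  qed
  show ?thesis
    unfolding D_def[symmetric]
  proof (rule krull_dim_eq)
    fix d assume d: "d < 2 * D"
    let ?d = "if d < D then d else d - D"
    have "?d < D" using d by auto
    then have d': "?d < k * k + b" by (simp only: D_def)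
    obtain i j where ij: "coord_pos k ?d = (i, j)" by force
    then have ij': "i < ?n" "j < ?n" using coord_pos_less[OF d'] by auto
    note coord = GL_torus_param_coord[OF d', unfolded ij]
    show "\<exists>F\<in>polynomial_functions (mat_pair_coords ?n). (\<forall>q. (\<forall>i\<ge>d. q i = ?b i) \<longrightarrow> F (?\<phi> q) = 0)
      \<and> (\<exists>q. (\<forall>i>d. q i = ?b i) \<and> F (?\<phi> q) \<noteq> 0)"
    proof (cases "d < D")
      case True
      show ?thesis
        by (rule separating_coordinate[OF mat_pair_coord_polynomial(1)[OF ij']])
          (use True coord in simp)
    next
      case False
      show ?thesis
        by (rule separating_coordinate[OF mat_pair_coord_polynomial(2)[OF ij']])
          (use False coord in simp)
    qed
  qed
qed

section \<open>The commuting variety\<close>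

text \<open>The determinant of this matrix in \<open>(A, B)\<close> vanishes if \<open>B\<close> is a polynomial in \<open>A\<close> of degree
  below \<open>j\<close>, but not for \<open>B = A ^ j\<close> if \<open>A\<close> is the nilpotent shift.\<close>

definition degree_mat :: "nat \<Rightarrow> nat \<Rightarrow> complex mat \<Rightarrow> complex mat \<Rightarrow> complex mat"
  where "degree_mat k j A B = mat k k (\<lambda>(r, i). if i = j then B $$ (r, 0)
    else if i < j then (A ^\<^sub>m i) $$ (r, 0) else if r = i then 1 else 0)"

lemma polynomial_mat_degree_mat:
  assumes "polynomial_mat X k M" and "polynomial_mat X k N"
  shows "polynomial_mat X k (\<lambda>q. degree_mat k j (M q) (N q))"
  unfolding polynomial_mat_def
proof (intro conjI allI impI)
  show "degree_mat k j (M q) (N q) \<in> carrier_mat k k" for q by (simp add: degree_mat_def)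
  fix r i assume ri: "r < k" "i < k"
  then have "0 < k" by simp
  then have "(\<lambda>q. N q $$ (r, 0)) \<in> polynomial_functions X"
    "(\<lambda>q. (M q ^\<^sub>m i) $$ (r, 0)) \<in> polynomial_functions X"
    using assms(2) polynomial_mat_pow[OF assms(1), of i] ri unfolding polynomial_mat_def by blast+
  then show "(\<lambda>q. degree_mat k j (M q) (N q) $$ (r, i)) \<in> polynomial_functions X"
    using ri by (cases i j rule: linorder_cases; cases "r = i")
      (simp_all add: degree_mat_def polynomial_functions.const)
qed

lemma degree_mat_singular:
  assumes j: "j < k" and c: "\<And>i. \<lbrakk>j \<le> i; i < k\<rbrakk> \<Longrightarrow> c i = 0"
  shows "det (degree_mat k j A (mat_polynomial k A c)) = 0"
proof -
  let ?M = "degree_mat k j A (mat_polynomial k A c)"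
  \<comment> \<open>A kernel vector: it subtracts column \<open>j\<close>, the first column of the
    polynomial, from the same combination of the first columns of the powers of
    \<open>A\<close>.\<close>
  let ?w = "vec k (\<lambda>i. if i < j then c i else if i = j then - 1 else 0)"
  have M: "?M \<in> carrier_mat k k" by (simp add: degree_mat_def)
  have "?M *\<^sub>v ?w = 0\<^sub>v k"
  proof (rule eq_vecI)
    fix r assume "r < dim_vec (0\<^sub>v k)"
    then have r: "r < k" by simp
    have "(?M *\<^sub>v ?w) $ r = (\<Sum>i\<in>{0..<k}. (if i < j then c i * (A ^\<^sub>m i) $$ (r, 0) else 0)
        - (if i = j then mat_polynomial k A c $$ (r, 0) else 0))"
      using r by (auto simp: degree_mat_def scalar_prod_def intro!: sum.cong)
    also have "\<dots> = (\<Sum>i\<in>{0..<k}. if i < j then c i * (A ^\<^sub>m i) $$ (r, 0) else 0)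
        - mat_polynomial k A c $$ (r, 0)"
      using j by (simp add: sum_subtractf)
    also have "(\<Sum>i\<in>{0..<k}. if i < j then c i * (A ^\<^sub>m i) $$ (r, 0) else 0)
        = (\<Sum>i<k. c i * (A ^\<^sub>m i) $$ (r, 0))"
      using c by (auto simp: lessThan_atLeast0 intro!: sum.cong)
    also have "\<dots> = mat_polynomial k A c $$ (r, 0)" using r j by (simp add: mat_polynomial_def)
    finally show "(?M *\<^sub>v ?w) $ r = 0\<^sub>v k $ r" using r by simp
  qed (simp add: degree_mat_def)
  moreover have "?w \<noteq> 0\<^sub>v k"
  proof
    assume w: "?w = 0\<^sub>v k"
    have "?w $ j = 0" unfolding w using j by simp
    then show False using j by simp
  qed
  ultimately show ?thesis using det_0_iff_vec_prod_zero[OF M] by (metis vec_carrier)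
qed

text \<open>It sends each basis vector to the next and the last to zero, so the first columns of its
  powers below \<open>k\<close> are the standard basis, and the first column of a polynomial in it
  lists the coefficients.\<close>

definition shift_mat :: "nat \<Rightarrow> complex mat"
  where "shift_mat k = mat k k (\<lambda>(r, s). if r = Suc s then 1 else 0)"

lemma shift_mat_pow:
  assumes "i < k" and "r < k"
  shows "(shift_mat k ^\<^sub>m i) $$ (r, 0) = (if r = i then 1 else 0)"
  using assms
proof (induction i arbitrary: r)
  case 0
  then show ?case by (simp add: shift_mat_def)
next
  case (Suc i)
  have N: "shift_mat k \<in> carrier_mat k k" by (simp add: shift_mat_def)
  have "(shift_mat k ^\<^sub>m Suc i) $$ (r, 0) = (\<Sum>l\<in>{0..<k}. shift_mat k $$ (r, l) * (shift_mat k ^\<^sub>m i) $$ (l, 0))"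
    unfolding pow_mat_Suc_left[OF N]
    using Suc.prems N carrier_matD[OF pow_carrier_mat[OF N], of i] by (simp add: scalar_prod_def del: pow_mat.simps)
  also have "\<dots> = (\<Sum>l\<in>{0..<k}. if l = i then if r = Suc i then 1 else 0 else 0)"
    using Suc by (intro sum.cong) (auto simp: shift_mat_def)
  also have "\<dots> = (if r = Suc i then 1 else 0)" using Suc.prems by simp
  finally show ?case .
qed

lemma degree_mat_shift:
  assumes "j < k"
  shows "degree_mat k j (shift_mat k) (mat_polynomial k (shift_mat k) (\<lambda>i. if i = j then 1 else 0)) = 1\<^sub>m k"
proof (rule eq_matI)
  fix r i assume "r < dim_row (1\<^sub>m k)" "i < dim_col (1\<^sub>m k)"
  then have ri: "r < k" "i < k" by simp_all
  have "mat_polynomial k (shift_mat k) (\<lambda>i. if i = j then 1 else 0) $$ (r, 0)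
      = (\<Sum>i<k. (if i = j then 1 else 0) * (shift_mat k ^\<^sub>m i) $$ (r, 0))"
    using ri by (simp add: mat_polynomial_def)
  also have "\<dots> = (\<Sum>i<k. if i = j then (shift_mat k ^\<^sub>m j) $$ (r, 0) else 0)"
    by (rule sum.cong) auto
  also have "\<dots> = (if r = j then 1 else 0)" using assms ri by (simp add: shift_mat_pow)
  finally show "degree_mat k j (shift_mat k) (mat_polynomial k (shift_mat k) (\<lambda>i. if i = j then 1 else 0)) $$ (r, i)
      = 1\<^sub>m k $$ (r, i)"
    using ri by (auto simp: degree_mat_def shift_mat_pow)
qed (simp_all add: degree_mat_def)

lemma block_diag_corner:
  assumes "A \<in> carrier_mat k k"
  shows "mat k k (\<lambda>ij. block_diag k b A t $$ ij) = A"
  using assms by (intro eq_matI) (auto simp: block_diag_index)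

text \<open>The parameters are, in this order, \<open>D\<close> for the first matrix,
  \<open>b\<close> for the torus part of the second, and \<open>k\<close> coefficients of the
  polynomial that gives its \<open>GL\<close> part. The constant coefficient precedes the others, so
  it can be read off while the second block is still scalar.\<close>

lemma krull_dim_commuting_pairs:
  assumes k: "k > 0"
  shows "krull_dim (zariski_mat_pair (k + b) (commuting_pairs (GL_torus k b)))
    = enat (k * k + b + b + k)"
proof -
  define D where "D = k * k + b"
  let ?n = "k + b" and ?M = "D + b + k"
  let ?C = "commuting_pairs (GL_torus k b)"
  let ?\<psi> = "GL_torus_param k b"
  let ?B = "\<lambda>q. mat_polynomial k (coord_mat k q) (\<lambda>i. q (D + b + i))"
  let ?\<chi> = "\<lambda>q. block_diag k b (?B q) (\<lambda>l. q (D + l))"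
  let ?\<phi> = "\<lambda>q. (?\<psi> q, ?\<chi> q)"
  let ?h = "\<lambda>q. det (?\<psi> q) * det (?\<chi> q)"
  \<comment> \<open>Index \<open>D + b\<close>, included here, belongs to the constant coefficient:
    its base value is 1 and those of the higher ones are 0, so both matrices are the identity at the
    base point.\<close>
  let ?b = "\<lambda>i. if i \<le> D + b then GL_torus_base k i else 0"
  have poly1: "polynomial_mat (nat_coords ?M) ?n ?\<psi>"
    by (rule polynomial_mat_GL_torus_param) (simp add: D_def)
  have poly2: "polynomial_mat (nat_coords ?M) ?n ?\<chi>"
    by (intro polynomial_mat_block_diag polynomial_mat_polynomial polynomial_mat_coord
        nat_coord_polynomial) (auto simp: D_def)
  have only_constant: "?B q = q (D + b) \<cdot>\<^sub>m 1\<^sub>m k" if "\<forall>i>D + b. q i = 0" for q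
  proof (rule eq_matI)
    fix r s assume "r < dim_row (q (D + b) \<cdot>\<^sub>m 1\<^sub>m k)" "s < dim_col (q (D + b) \<cdot>\<^sub>m 1\<^sub>m k)"
    then have rs: "r < k" "s < k" by simp_all
    have "?B q $$ (r, s) = (\<Sum>i<k. q (D + b + i) * (coord_mat k q ^\<^sub>m i) $$ (r, s))"
      using rs by (simp add: mat_polynomial_def)
    also have "\<dots> = (\<Sum>i<k. if i = 0 then q (D + b) * (coord_mat k q ^\<^sub>m 0) $$ (r, s) else 0)"
      by (rule sum.cong) (use that in auto)
    also have "\<dots> = (q (D + b) \<cdot>\<^sub>m 1\<^sub>m k) $$ (r, s)"
      using rs k by (simp add: coord_mat_def)
    finally show "?B q $$ (r, s) = (q (D + b) \<cdot>\<^sub>m 1\<^sub>m k) $$ (r, s)" .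
  qed (simp_all add: mat_polynomial_def)
  interpret parametrization "mat_pair_coords ?n" ?C ?M ?\<phi> ?h ?b
  proof
    show "(\<lambda>q. x (?\<phi> q)) \<in> polynomial_functions (nat_coords ?M)"
      if "x \<in> mat_pair_coords ?n" for x
      using mat_pair_coords_compose[OF poly1 poly2 that] .
    show "?h \<in> polynomial_functions (nat_coords ?M)"
      by (intro polynomial_functions.mult polynomial_mat_det[OF poly1] polynomial_mat_det[OF poly2])
    show "?\<phi> q \<in> ?C" if "?h q \<noteq> 0" for q
    proof -
      have "?\<psi> q \<in> GL_torus k b" using that GL_torus_param_mem by auto
      moreover have "?\<chi> q \<in> GL_torus k b"
        using that by (intro block_diag_mem) auto
      moreover have "?\<psi> q * ?\<chi> q = ?\<chi> q * ?\<psi> q"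
        unfolding GL_torus_param_def block_diag_mult[OF coord_mat_carrier mat_polynomial_carrier]
          block_diag_mult[OF mat_polynomial_carrier coord_mat_carrier]
        by (simp add: mat_polynomial_commute[OF coord_mat_carrier] mult.commute)
      ultimately show ?thesis by (simp add: commuting_pairs_def)
    qed
    have "?\<psi> ?b = ?\<psi> (GL_torus_base k)" by (rule GL_torus_param_cong) (simp add: D_def)
    moreover have "?B ?b = 1\<^sub>m k"
      using only_constant[of ?b] by (simp add: GL_torus_base_def D_def) (auto intro!: eq_matI)
    then have "?\<chi> ?b = block_diag k b (1\<^sub>m k) (\<lambda>_. 1)"
      by (simp, intro block_diag_cong) (simp add: GL_torus_base_def D_def)
    ultimately show "?h ?b \<noteq> 0" by (simp add: GL_torus_param_base block_diag_one)
    show "F p = 0" if F: "F \<in> polynomial_functions (mat_pair_coords ?n)"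
      and 0: "\<And>q. F (?\<phi> q) = 0" and p: "p \<in> ?C" for F p
    proof -
      obtain A s B t where A: "A \<in> carrier_mat k k" "fst p = block_diag k b A s"
        and B: "B \<in> carrier_mat k k" "snd p = block_diag k b B t"
        and comm: "fst p * snd p = snd p * fst p"
        using p by (auto simp: commuting_pairs_def GL_torus_def)
      have "block_diag k b (A * B) (\<lambda>i. s i * t i) = block_diag k b (B * A) (\<lambda>i. t i * s i)"
        using comm unfolding A(2) B(2) block_diag_mult[OF A(1) B(1)] block_diag_mult[OF B(1) A(1)] .
      then have AB: "A * B = B * A"
        using block_diag_corner[OF mult_carrier_mat[OF A(1) B(1)], of b]
          block_diag_corner[OF mult_carrier_mat[OF B(1) A(1)], of b] by metis
      \<comment> \<open>The torus parts \<open>s\<close> and \<open>t\<close> stay fixed while the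
        blocks vary. Singular matrices may occur on the way, which is harmless because
        \<open>F\<close> vanishes at \<open>?\<phi> q\<close> for every \<open>q\<close>.\<close>
      have "F (block_diag k b A s, block_diag k b B t) = 0"
      proof (rule commuting_pairs_dense[OF A(1) B(1) AB,
            where F = "\<lambda>A B. F (block_diag k b A s, block_diag k b B t)"])
        fix A' :: "complex mat" and c :: "nat \<Rightarrow> complex" assume A': "A' \<in> carrier_mat k k"
        let ?q = "\<lambda>i. if i < k * k then A' $$ (i div k, i mod k) else if i < D then s (i - k * k)
          else if i < D + b then t (i - D) else c (i - (D + b))"
        have "coord_mat k ?q = coord_mat k (\<lambda>i. A' $$ (i div k, i mod k))"
          by (rule coord_mat_cong) simp
        also have "\<dots> = A'" by (rule coord_mat_surj[OF A'])
        finally have cm: "coord_mat k ?q = A'" .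
        have "?\<psi> ?q = block_diag k b A' s"
          unfolding GL_torus_param_def cm by (rule block_diag_cong) (simp add: D_def)
        moreover have "?\<chi> ?q = block_diag k b (mat_polynomial k A' c) t"
          unfolding cm by (simp add: D_def, intro block_diag_cong) simp
        ultimately show "F (block_diag k b A' s, block_diag k b (mat_polynomial k A' c) t) = 0"
          using 0[of ?q] by simp
      next
        fix M assume M: "polynomial_mat {\<lambda>t. t} k M"
        show "(\<lambda>u. F (block_diag k b (M u) s, block_diag k b B t)) \<in> polynomial_functions {\<lambda>t. t}"
        proof (rule polynomial_functions_compose[OF F])
          fix x assume x: "x \<in> mat_pair_coords ?n"
          have "polynomial_mat {\<lambda>t. t} ?n (\<lambda>u. block_diag k b (M u) s)"
            by (intro polynomial_mat_block_diag M polynomial_functions.const)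
          moreover have "polynomial_mat {\<lambda>t. t} ?n (\<lambda>_. block_diag k b B t)"
            by (intro polynomial_mat_const block_diag_carrier B(1))
          ultimately show "(\<lambda>u. x (block_diag k b (M u) s, block_diag k b B t))
              \<in> polynomial_functions {\<lambda>t. t}"
            using x by (rule mat_pair_coords_compose)
        qed
      qed
      then show ?thesis using A(2) B(2) by (metis prod.collapse)
    qed
  qed
  show ?thesis
    unfolding D_def[symmetric]
  proof (rule krull_dim_eq)
    fix d assume d: "d < ?M"
    consider "d < D" | "D \<le> d" "d < D + b" | "d = D + b" | j where "d = D + b + j" "0 < j" "j < k"
      using d by (metis add.commute add_less_cancel_left le_add_diff_inverse linorder_cases
          not_less zero_less_diff)
    then show "\<exists>F\<in>polynomial_functions (mat_pair_coords ?n). (\<forall>q. (\<forall>i\<ge>d. q i = ?b i) \<longrightarrow> F (?\<phi> q) = 0)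
      \<and> (\<exists>q. (\<forall>i>d. q i = ?b i) \<and> F (?\<phi> q) \<noteq> 0)"
    proof cases
      case 1
      then have d': "d < k * k + b" by (simp add: D_def)
      obtain i j where ij: "coord_pos k d = (i, j)" by force
      then have ij': "i < ?n" "j < ?n" using coord_pos_less[OF d'] by auto
      show ?thesis
        by (rule separating_coordinate[OF mat_pair_coord_polynomial(1)[OF ij']])
          (use GL_torus_param_coord[OF d', unfolded ij] in simp)
    next
      case 2
      then obtain l where l: "d = D + l" "l < b" by (metis le_iff_add nat_add_left_cancel_less)
      then have i: "k + l < ?n" by simp
      show ?thesis
        by (rule separating_coordinate[OF mat_pair_coord_polynomial(2)[OF i i]])
          (simp add: block_diag_index[OF mat_polynomial_carrier i i] l(1))
    next
      case 3
      have i: "0 < ?n" using k by simp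
      show ?thesis
      proof (rule separating_coordinate[OF mat_pair_coord_polynomial(2)[OF i i]])
        fix q :: "nat \<Rightarrow> complex" assume "\<forall>i>d. q i = ?b i"
        then have "?B q = q (D + b) \<cdot>\<^sub>m 1\<^sub>m k" using 3 by (intro only_constant) auto
        then show "snd (?\<phi> q) $$ (0, 0) = q d"
          using k 3 by (simp add: block_diag_index[OF smult_carrier_mat[OF one_carrier_mat] i i])
      qed
    next
      case (4 j)
      let ?cor = "\<lambda>A. mat k k (\<lambda>ij. A $$ ij)"
      let ?F = "\<lambda>p. det (degree_mat k j (?cor (fst p)) (?cor (snd p)))"
      have cor: "?cor (?\<psi> q) = coord_mat k q" "?cor (?\<chi> q) = ?B q" for q
        unfolding GL_torus_param_def by (intro block_diag_corner; simp)+
      have "polynomial_mat (mat_pair_coords ?n) k (\<lambda>p. ?cor (fst p))"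
        "polynomial_mat (mat_pair_coords ?n) k (\<lambda>p. ?cor (snd p))"
        unfolding polynomial_mat_def by (auto intro: mat_pair_coord_polynomial)
      then have "polynomial_mat (mat_pair_coords ?n) k
          (\<lambda>p. degree_mat k j (?cor (fst p)) (?cor (snd p)))"
        by (rule polynomial_mat_degree_mat)
      then have F: "?F \<in> polynomial_functions (mat_pair_coords ?n)" by (rule polynomial_mat_det)
      \<comment> \<open>As \<open>j > 0\<close>, the base values from index \<open>d\<close> on are
        zero, so the polynomial has degree below \<open>j\<close>.\<close>
      have zero: "?F (?\<phi> q) = 0" if "\<forall>i\<ge>d. q i = ?b i" for q
        unfolding fst_conv snd_conv cor
        by (rule degree_mat_singular) (use that 4 in auto)
      \<comment> \<open>The first block is the shift and the polynomial is the monomial of degree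
        \<open>j\<close>. The shift is singular, so the pair lies outside the group;
        \<open>krull_dim_eq\<close> admits such a witness.\<close>
      let ?q = "\<lambda>i. if i < k * k then if i div k = Suc (i mod k) then 1 else 0
        else if i = d then 1 else (0 :: complex)"
      have "coord_mat k ?q = shift_mat k"
        unfolding coord_mat_def shift_mat_def using coord_index_less by (intro cong_mat) auto
      moreover have "(\<lambda>i. ?q (D + b + i)) = (\<lambda>i. if i = j then 1 else 0)"
        using 4 by (auto simp: D_def)
      ultimately have "?F (?\<phi> ?q) = 1"
        unfolding fst_conv snd_conv cor(1)[of ?q] cor(2)[of ?q] using degree_mat_shift[OF 4(3)] by simp
      moreover have "\<forall>i>d. ?q i = ?b i" using 4 by (auto simp: D_def)
      ultimately show ?thesis using F zero by (intro bexI[of _ ?F] conjI exI[of _ ?q]) auto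
    qed
  qed
qed

section \<open>Realizing a given rational number\<close>

lemma commuting_probability_GL_torus:
  assumes "k > 0"
  shows "commuting_probability (k + b) (GL_torus k b)
    = real (k * k + b + b + k) / real (2 * (k * k + b))"
  unfolding commuting_probability_def krull_dim_GL_torus krull_dim_GL_torus_pairs
    krull_dim_commuting_pairs[OF assms]
  using assms by (simp add: zero_enat_def)

theorem proposition5p2:
  fixes \<alpha> :: real
  assumes "\<alpha> \<in> \<rat>" and "1 / 2 < \<alpha>" and "\<alpha> \<le> 1"
  shows "\<exists>n G. linear_algebraic_group n G \<and> connected_alg_group n G \<and> reductive n G \<and>
    commuting_probability n G = \<alpha>"
proof -
  have "2 * \<alpha> - 1 \<in> \<rat>" using assms(1) by simp
  then obtain p q :: nat where q: "q \<noteq> 0" and pq: "\<bar>2 * \<alpha> - 1\<bar> = real p / real q"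
    by (rule Rats_abs_nat_div_natE)
  have \<alpha>: "\<alpha> = (1 + real p / real q) / 2" using pq assms(2) by simp
  have p: "0 < p" using \<alpha> assms(2) q by (cases "p = 0") auto
  have "real p / real q \<le> 1" using \<alpha> assms(3) by simp
  then have "p \<le> q" using q by (simp add: divide_le_eq)
  have "\<exists>k b. k > 0 \<and> real (k * k + b + b + k) / real (2 * (k * k + b)) = \<alpha>"
  proof (cases "p = q")
    case True
    then show ?thesis using q \<alpha> by (intro exI[of _ 1] exI[of _ 0]) simp
  next
    case False
    define m where "m = q - p"
    have m: "m > 0" "real m = real q - real p" using False \<open>p \<le> q\<close> by (simp_all add: m_def of_nat_diff)
    \<comment> \<open>The equation to solve is \<open>p / q = (k + b) / (k * k + b)\<close>, that
      is, \<open>b * (q - p) = k * (p * k - q)\<close>. Taking \<open>k\<close> as a multiple of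
      \<open>q - p\<close> makes \<open>b\<close> an integer; the further factor \<open>q\<close>
      makes \<open>p * k - q\<close> nonnegative.\<close>
    define k where "k = q * m"
    have "q \<le> p * k" using p m q by (simp add: k_def)
    define b where "b = q * (p * k - q)"
    have b: "real b = real q * (real p * real k - real q)"
      using \<open>q \<le> p * k\<close> by (simp add: b_def of_nat_diff)
    have k: "k > 0" "real k = real q * (real q - real p)" using q m by (simp_all add: k_def)
    have "real b * (real q - real p) = real k * (real p * real k - real q)"
      unfolding b k(2) by (simp add: algebra_simps)
    then have "real q * (real k + real b) = real p * (real k * real k + real b)"
      by (simp add: algebra_simps)
    moreover have pos: "real k * real k + real b > 0" using k(1) by (intro add_pos_nonneg) auto
    ultimately have pq': "real p / real q = (real k + real b) / (real k * real k + real b)"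
      using q by (simp add: frac_eq_eq mult.commute)
    then have "\<alpha> = real (k * k + b + b + k) / real (2 * (k * k + b))"
      unfolding \<alpha> pq' using pos by (simp add: field_simps)
    then show ?thesis using k(1) by metis
  qed
  then obtain k b where "k > 0" "real (k * k + b + b + k) / real (2 * (k * k + b)) = \<alpha>" by blast
  then show ?thesis
    using linear_algebraic_group_GL_torus[of k b] connected_GL_torus[of k b]
      reductive_GL_torus[of k b] commuting_probability_GL_torus[of k b] by metis
qed

end
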